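(* Let $N\ge 2$ and let $A=(a_1,\ldots,a_N)$, $B=(b_1,\ldots,b_N)\in\mathbb{R}^N$ be two nonnegative vectors. Let $i\in\{1,\ldots,N\}$. If $a_j=b_j$ for all $j\in\{1,\ldots,N\}\setminus\{i\}$ and $a_i=b_i+1$, then $$C_{A,B,N}=a_i,$$ where $C_{A,B,N}$ is the isoperimetric constant defined in the context.
   Context: A vector in $\mathbb{R}^N$ is called nonnegative if all its entries are nonnegative. For a nonnegative vector $A=(a_1,\ldots,a_N)$ and $x\in\mathbb{R}^N$, the monomial weight is $x^A:=|x_1|^{a_1}\cdots|x_N|^{a_N}$ (a factor with exponent $0$ is equal to $1$). With $a=a_1+\cdots+a_N$ and $b=b_1+\cdots+b_N$, define $$C_{A,B,N}:=\inf\left\{\frac{\int_{\partial\Omega}x^{A}\,d\mathcal{H}^{N-1}(x)}{\left[\int_{\Omega}x^{B}\,dx\right]^{\frac{N+a-1}{N+b}}}\;:\;\Omega\subset\mathbb{R}^N\text{ is a smooth open set and }0<\int_{\Omega}x^{B}\,dx<\infty\right\}\in[0,+\infty),$$ where $\mathcal{H}^{N-1}$ is the $(N-1)$-dimensional Hausdorff measure. *)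

theory Defs
  imports "HOL-Analysis.Analysis"
begin

section \<open>Hausdorff measure\<close>

text \<open>The factor \<open>unit_ball_vol m / 2 ^ m\<close> is the standard normalisation, under which the
  \<open>m\<close>-dimensional Hausdorff measure on an \<open>m\<close>-dimensional Euclidean space is Lebesgue measure.
  The empty set is treated separately only because of \<open>0 ^ 0 = 1\<close>.\<close>

definition hausdorff_gauge :: "nat \<Rightarrow> 'a::metric_space set \<Rightarrow> ennreal" where
  "hausdorff_gauge m U =
     (if U = {} then 0 else ennreal (unit_ball_vol (real m) * (diameter U / 2) ^ m))"

text \<open>Boundedness has to be required of the covering sets, since \<^const>\<open>diameter\<close> is unspecified on
  unbounded sets.\<close>

definition hausdorff_pre :: "nat \<Rightarrow> real \<Rightarrow> 'a::metric_space set \<Rightarrow> ennreal" where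
  "hausdorff_pre m \<delta> S =
     (INF U \<in> {U :: nat \<Rightarrow> 'a set. S \<subseteq> (\<Union>k. U k) \<and> (\<forall>k. bounded (U k) \<and> diameter (U k) \<le> \<delta>)}.
        \<Sum>k. hausdorff_gauge m (U k))"

definition hausdorff_outer :: "nat \<Rightarrow> 'a::metric_space set \<Rightarrow> ennreal" where
  "hausdorff_outer m S = (SUP \<delta>\<in>{0<..}. hausdorff_pre m \<delta> S)"

definition hausdorff :: "nat \<Rightarrow> 'a::metric_space measure" where
  "hausdorff m = measure_of UNIV (sets borel) (hausdorff_outer m)"

text \<open>Since \<^const>\<open>measure_of\<close> yields the null measure unless its argument is countably additive, we
  check below (\<open>emeasure_hausdorff\<close>) that \<^term>\<open>hausdorff m\<close> does agree with the outer measure on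
  Borel sets.\<close>

lemma space_hausdorff [simp]: "space (hausdorff m) = UNIV"
  by (simp add: hausdorff_def)

lemma sets_hausdorff [simp, measurable_cong]: "sets (hausdorff m) = sets borel"
  by (simp add: hausdorff_def sets.sigma_sets_eq[of borel, simplified])

subsection \<open>Caratheodory's criterion for metric outer measures\<close>

lemma metric_outer_measure_closed:
  fixes f :: "'a::metric_space set \<Rightarrow> ennreal"
  assumes f0: "f {} = 0"
    and mono: "\<And>A B. A \<subseteq> B \<Longrightarrow> f A \<le> f B"
    and csub: "\<And>A :: nat \<Rightarrow> 'a set. f (\<Union>i. A i) \<le> (\<Sum>i. f (A i))"
    and sep: "\<And>A B d. 0 < d \<Longrightarrow> (\<And>x y. x \<in> A \<Longrightarrow> y \<in> B \<Longrightarrow> d \<le> dist x y) \<Longrightarrow> f A + f B \<le> f (A \<union> B)"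
    and C: "closed C"
  shows "f (X \<inter> C) + f (X - C) = f X"
proof (rule antisym)
  have sub: "f (A \<union> B) \<le> f A + f B" for A B
  proof -
    have "f (\<Union>i. binaryset A B i) \<le> (\<Sum>i. f (binaryset A B i))" by (rule csub)
    then show ?thesis by (simp add: UN_binaryset_eq suminf_binaryset_eq f0)
  qed
  show "f X \<le> f (X \<inter> C) + f (X - C)"
    using sub[of "X \<inter> C" "X - C"] by (simp add: Int_Diff_Un)
  show "f (X \<inter> C) + f (X - C) \<le> f X"
  proof (cases "C = {} \<or> f X = top")
    case True
    then show ?thesis by (auto simp: f0)
  next
    case False
    then have Cne: "C \<noteq> {}" and fin: "f X < top" by (auto simp: less_top)
    define g where "g x = infdist x C" for x
    have g_pos: "g x > 0" if "x \<notin> C" for x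
      using C Cne that infdist_pos_not_in_closed unfolding g_def by blast
    have g_C: "g x = 0" if "x \<in> C" for x
      using that by (simp add: g_def)
    have g_lip: "g x - g y \<le> dist x y" for x y
      using infdist_triangle[of x C y] by (simp add: g_def)
    define D where "D n = {x\<in>X. 1 / real (Suc n) \<le> g x}" for n
    define R where "R n = {x\<in>X. 1 / real (n + 2) \<le> g x \<and> g x < 1 / real (Suc n)}" for n
    have levels: "f (A \<inter> X) + f (B \<inter> X) \<le> f X"
      if "s < t" "\<And>x. x \<in> A \<Longrightarrow> t \<le> g x" "\<And>x. x \<in> B \<Longrightarrow> g x \<le> s" for A B s t
    proof -
      have "f (A \<inter> X) + f (B \<inter> X) \<le> f ((A \<inter> X) \<union> (B \<inter> X))"
      proof (rule sep)
        show "0 < t - s" using that by simp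
        show "t - s \<le> dist x y" if "x \<in> A \<inter> X" "y \<in> B \<inter> X" for x y
          using that g_lip[of x y] \<open>\<And>x. x \<in> A \<Longrightarrow> t \<le> g x\<close>[of x] \<open>\<And>x. x \<in> B \<Longrightarrow> g x \<le> s\<close>[of y] by auto
      qed
      also have "\<dots> \<le> f X" by (intro mono) auto
      finally show ?thesis .
    qed
    have parity: "(\<Sum>k<n. f (R (2 * k + p))) \<le> f (\<Union>k<n. R (2 * k + p))" for n p :: nat
    proof (induction n)
      case 0
      then show ?case by simp
    next
      case (Suc n)
      have "(\<Sum>k<Suc n. f (R (2 * k + p))) \<le> f (\<Union>k<n. R (2 * k + p)) + f (R (2 * n + p))"
        using Suc by (simp add: add_right_mono)
      also have "\<dots> \<le> f ((\<Union>k<n. R (2 * k + p)) \<union> R (2 * n + p))"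
      proof (cases "n = 0")
        case True
        then show ?thesis by (simp add: f0)
      next
        case n: False
        show ?thesis
        proof (rule sep)
          let ?t = "1 / real (2 * n + p)" and ?s = "1 / real (Suc (2 * n + p))"
          have "?s < ?t" using n by (intro divide_strict_left_mono) auto
          then show "0 < ?t - ?s" by simp
          fix x y assume x: "x \<in> (\<Union>k<n. R (2 * k + p))" and y: "y \<in> R (2 * n + p)"
          from x obtain k where k: "k < n" "x \<in> R (2 * k + p)" by auto
          have "?t \<le> 1 / real (2 * k + p + 2)"
            using k(1) by (intro divide_left_mono) (auto simp: mult_pos_pos)
          also have "\<dots> \<le> g x" using k(2) by (simp add: R_def)
          finally have "?t \<le> g x" .
          moreover have "g y < ?s" using y by (simp add: R_def)
          ultimately show "?t - ?s \<le> dist x y" using g_lip[of x y] by linarith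
        qed
      qed
      also have "(\<Union>k<n. R (2 * k + p)) \<union> R (2 * n + p) = (\<Union>k<Suc n. R (2 * k + p))"
        by (auto simp: lessThan_Suc)
      finally show ?case .
    qed
    have par_le: "(\<Sum>k<n. f (R (2 * k + p))) \<le> f X" for n p :: nat
      using parity[where n = n and p = p] by (rule order_trans) (intro mono, auto simp: R_def)
    have split: "(\<Sum>k<2 * n. f (R k)) = (\<Sum>k<n. f (R (2 * k + 0))) + (\<Sum>k<n. f (R (2 * k + 1)))" for n
      by (induction n) (simp_all add: algebra_simps)
    have partial: "(\<Sum>k<n. f (R k)) \<le> f X + f X" for n
    proof -
      have "(\<Sum>k<n. f (R k)) \<le> (\<Sum>k<2 * n. f (R k))"
        by (intro sum_mono2) auto
      also have "\<dots> \<le> f X + f X"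
        unfolding split by (intro add_mono par_le)
      finally show ?thesis .
    qed
    define r where "r k = enn2real (f (R k))" for k
    have fR: "f (R k) = ennreal (r k)" for k
    proof -
      have "f (R k) \<le> f X" by (intro mono) (auto simp: R_def)
      then show ?thesis using fin by (simp add: r_def)
    qed
    have r0: "0 \<le> r k" for k by (simp add: r_def)
    have "(\<Sum>k. ennreal (r k)) \<le> f X + f X"
      using partial by (intro suminf_le_const) (auto simp: fR)
    then have "(\<Sum>k. ennreal (r k)) \<noteq> top"
      using fin by (auto simp: top_unique)
    then have sr: "summable r"
      using summable_suminf_not_top[of r] r0 by blast
    have "f (X \<inter> C) + f (X - C) \<le> f X + ennreal (\<Sum>k. r (k + n))" for n
    proof -
      have "X - C \<subseteq> D n \<union> (\<Union>k. R (k + n))"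
      proof
        fix x assume x: "x \<in> X - C"
        show "x \<in> D n \<union> (\<Union>k. R (k + n))"
        proof (cases "x \<in> D n")
          case False
          define P where "P j \<longleftrightarrow> 1 / real (Suc j) \<le> g x" for j
          have "0 < g x" using x g_pos by auto
          then obtain j where "inverse (real (Suc j)) < g x"
            using reals_Archimedean by blast
          then have "P j" by (simp add: P_def inverse_eq_divide)
          define j0 where "j0 = (LEAST j. P j)"
          have Pj0: "P j0" unfolding j0_def using \<open>P j\<close> by (rule LeastI)
          have nP: "\<not> P i" if "i \<le> n" for i
          proof
            assume "P i"
            have "1 / real (Suc n) \<le> 1 / real (Suc i)"
              using that by (intro divide_left_mono) auto
            with \<open>P i\<close> False x show False by (auto simp: P_def D_def)
          qed
          then have "n < j0" using Pj0 not_less by blast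
          then obtain k where k: "j0 = Suc (k + n)"
            by (metis add.commute less_imp_Suc_add)
          have "\<not> P (k + n)" using not_less_Least[of "k + n" P] k j0_def by simp
          then have "x \<in> R (k + n)" using Pj0 x k by (auto simp: P_def R_def add.commute)
          then show ?thesis by blast
        qed simp
      qed
      then have "f (X - C) \<le> f (D n \<union> (\<Union>k. R (k + n)))" by (rule mono)
      also have "\<dots> \<le> f (D n) + (\<Sum>k. f (R (k + n)))"
        by (rule order_trans[OF sub]) (intro add_left_mono csub)
      also have "(\<Sum>k. f (R (k + n))) = ennreal (\<Sum>k. r (k + n))"
        unfolding fR by (rule suminf_ennreal2) (simp_all add: r0 sr summable_ignore_initial_segment)
      finally have "f (X \<inter> C) + f (X - C) \<le> (f (D n) + f (X \<inter> C)) + ennreal (\<Sum>k. r (k + n))"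
        by (simp add: add_ac add_left_mono)
      also have "f (D n) + f (X \<inter> C) \<le> f X"
      proof -
        have "D n \<inter> X = D n" "(X \<inter> C) \<inter> X = X \<inter> C" by (auto simp: D_def)
        then show ?thesis
          using levels[of 0 "1 / real (Suc n)" "D n" "X \<inter> C"] g_C by (simp add: D_def)
      qed
      finally show ?thesis by (simp add: add_right_mono)
    qed
    moreover have "(\<lambda>n. f X + ennreal (\<Sum>k. r (k + n))) \<longlonglongrightarrow> f X + ennreal 0"
      by (intro tendsto_add tendsto_const tendsto_ennrealI suminf_exist_split2 sr)
    ultimately have "f (X \<inter> C) + f (X - C) \<le> f X + ennreal 0"
      by (intro LIMSEQ_le_const) auto
    then show ?thesis by simp
  qed
qed

subsection \<open>The Hausdorff outer measure\<close>

lemma hausdorff_gauge_empty [simp]: "hausdorff_gauge m {} = 0"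
  by (simp add: hausdorff_gauge_def)

lemma hausdorff_pre_empty: "0 < \<delta> \<Longrightarrow> hausdorff_pre m \<delta> {} = 0"
  unfolding hausdorff_pre_def
  by (intro antisym INF_lower2[of "\<lambda>_. {}"]) auto

lemma hausdorff_pre_mono: "A \<subseteq> B \<Longrightarrow> hausdorff_pre m \<delta> A \<le> hausdorff_pre m \<delta> B"
  unfolding hausdorff_pre_def by (intro INF_superset_mono) auto

lemma hausdorff_pre_antimono: "\<delta> \<le> \<delta>' \<Longrightarrow> hausdorff_pre m \<delta>' A \<le> hausdorff_pre m \<delta> A"
  unfolding hausdorff_pre_def by (intro INF_superset_mono) (auto intro: order_trans)

lemma hausdorff_pre_UN:
  fixes A :: "nat \<Rightarrow> 'a::metric_space set"
  shows "hausdorff_pre m \<delta> (\<Union>i. A i) \<le> (\<Sum>i. hausdorff_pre m \<delta> (A i))"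
proof (rule ennreal_le_epsilon)
  fix e :: real
  assume e: "0 < e" and fin: "(\<Sum>n. hausdorff_pre m \<delta> (A n)) < top"
  then have "hausdorff_pre m \<delta> (A n) < hausdorff_pre m \<delta> (A n) + e * (1/2) ^ Suc n" for n
    by (auto simp add: less_top dest!: ennreal_suminf_lessD)
  then have "\<exists>U :: nat \<Rightarrow> 'a set. A n \<subseteq> (\<Union>k. U k) \<and> (\<forall>k. bounded (U k) \<and> diameter (U k) \<le> \<delta>) \<and>
      (\<Sum>k. hausdorff_gauge m (U k)) < hausdorff_pre m \<delta> (A n) + e * (1/2) ^ Suc n" for n
    by (subst (asm) (1) hausdorff_pre_def) (auto simp: INF_less_iff)
  then obtain B :: "nat \<Rightarrow> nat \<Rightarrow> 'a set" where B: "\<And>n. A n \<subseteq> (\<Union>k. B n k)"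
      "\<And>n k. bounded (B n k) \<and> diameter (B n k) \<le> \<delta>"
      "\<And>n. (\<Sum>k. hausdorff_gauge m (B n k)) < hausdorff_pre m \<delta> (A n) + e * (1/2) ^ Suc n"
    by metis
  define W where "W = case_prod B o prod_decode"
  have "hausdorff_pre m \<delta> (\<Union>i. A i) \<le> (\<Sum>i. hausdorff_gauge m (W i))"
    unfolding hausdorff_pre_def
  proof (rule INF_lower, safe)
    fix x n assume "x \<in> A n"
    then obtain k where "x \<in> B n k" using B(1) by blast
    then show "x \<in> (\<Union>k. W k)"
      by (auto simp: W_def intro!: exI[of _ "prod_encode (n, k)"])
  qed (use B(2) in \<open>auto simp: W_def split: prod.split\<close>)
  also have "\<dots> = (\<Sum>n. \<Sum>k. hausdorff_gauge m (B n k))"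
    unfolding W_def comp_def by (intro suminf_ennreal_2dimen) (auto simp: split_def)
  also have "\<dots> \<le> (\<Sum>n. hausdorff_pre m \<delta> (A n) + e * (1/2) ^ Suc n)"
    using B(3) by (intro suminf_le) (auto intro: less_imp_le)
  also have "\<dots> = (\<Sum>n. hausdorff_pre m \<delta> (A n)) + (\<Sum>n. ennreal e * ennreal ((1/2) ^ Suc n))"
    using e by (subst suminf_add[symmetric])
      (auto simp del: ennreal_suminf_cmult simp add: ennreal_mult[symmetric])
  also have "\<dots> = (\<Sum>n. hausdorff_pre m \<delta> (A n)) + e"
    unfolding ennreal_suminf_cmult
    by (subst suminf_ennreal_eq[OF zero_le_power power_half_series]) auto
  finally show "hausdorff_pre m \<delta> (\<Union>i. A i) \<le> (\<Sum>n. hausdorff_pre m \<delta> (A n)) + e" .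
qed

lemma hausdorff_pre_separated:
  assumes d: "\<delta> < d" and sep: "\<And>x y. x \<in> A \<Longrightarrow> y \<in> B \<Longrightarrow> d \<le> dist x y"
  shows "hausdorff_pre m \<delta> A + hausdorff_pre m \<delta> B \<le> hausdorff_pre m \<delta> (A \<union> B)"
  unfolding hausdorff_pre_def[of m \<delta> "A \<union> B"]
proof (rule INF_greatest, safe)
  fix U :: "nat \<Rightarrow> 'a set"
  assume cov: "A \<union> B \<subseteq> (\<Union>k. U k)" and U: "\<forall>k. bounded (U k) \<and> diameter (U k) \<le> \<delta>"
  define V where "V S k = (if U k \<inter> S = {} then {} else U k)" for S k
  have pre_le: "hausdorff_pre m \<delta> S \<le> (\<Sum>k. hausdorff_gauge m (V S k))" if "S \<subseteq> A \<union> B" "0 \<le> \<delta>" for S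
    unfolding hausdorff_pre_def
  proof (rule INF_lower, safe)
    fix x assume "x \<in> S"
    with cov that obtain k where "x \<in> U k" by blast
    with \<open>x \<in> S\<close> have "x \<in> V S k" by (auto simp: V_def)
    then show "x \<in> (\<Union>k. V S k)" by blast
  qed (use U that in \<open>simp_all add: V_def\<close>)
  have "0 \<le> diameter (U 0)" using U by (intro diameter_ge_0) auto
  also have "\<dots> \<le> \<delta>" using U by auto
  finally have "0 \<le> \<delta>" .
  have disj: "U k \<inter> A = {} \<or> U k \<inter> B = {}" for k
  proof (rule ccontr)
    assume "\<not> ?thesis"
    then obtain x y where "x \<in> U k" "x \<in> A" "y \<in> U k" "y \<in> B" by auto
    then have "d \<le> diameter (U k)"
      using sep[of x y] diameter_bounded_bound[of "U k" x y] U by (meson order_trans)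
    with U d show False by (meson leD order_trans)
  qed
  have "hausdorff_pre m \<delta> A + hausdorff_pre m \<delta> B
      \<le> (\<Sum>k. hausdorff_gauge m (V A k)) + (\<Sum>k. hausdorff_gauge m (V B k))"
    using \<open>0 \<le> \<delta>\<close> by (intro add_mono pre_le) auto
  also have "\<dots> = (\<Sum>k. hausdorff_gauge m (V A k) + hausdorff_gauge m (V B k))"
    by (intro suminf_add) auto
  also have "\<dots> \<le> (\<Sum>k. hausdorff_gauge m (U k))"
  proof (intro suminf_le)
    fix k
    show "hausdorff_gauge m (V A k) + hausdorff_gauge m (V B k) \<le> hausdorff_gauge m (U k)"
      using disj[of k] by (auto simp: V_def)
  qed auto
  finally show "hausdorff_pre m \<delta> A + hausdorff_pre m \<delta> B \<le> (\<Sum>k. hausdorff_gauge m (U k))" .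
qed

lemma hausdorff_outer_empty [simp]: "hausdorff_outer m {} = 0"
  unfolding hausdorff_outer_def by (simp add: hausdorff_pre_empty bot_ennreal)

lemma hausdorff_outer_mono: "A \<subseteq> B \<Longrightarrow> hausdorff_outer m A \<le> hausdorff_outer m B"
  unfolding hausdorff_outer_def by (intro SUP_mono) (auto intro: hausdorff_pre_mono)

lemma hausdorff_outer_UN:
  "hausdorff_outer m (\<Union>i. A i) \<le> (\<Sum>i::nat. hausdorff_outer m (A i))"
  unfolding hausdorff_outer_def[of m "\<Union>i. A i"]
proof (rule SUP_least)
  fix \<delta> :: real assume "\<delta> \<in> {0<..}"
  then have "(\<Sum>i. hausdorff_pre m \<delta> (A i)) \<le> (\<Sum>i. hausdorff_outer m (A i))"
    by (intro suminf_le) (auto simp: hausdorff_outer_def intro!: SUP_upper)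
  with hausdorff_pre_UN show "hausdorff_pre m \<delta> (\<Union>i. A i) \<le> (\<Sum>i. hausdorff_outer m (A i))"
    by (rule order_trans)
qed

lemma hausdorff_outer_separated:
  assumes d: "0 < d" and sep: "\<And>x y. x \<in> A \<Longrightarrow> y \<in> B \<Longrightarrow> d \<le> dist x y"
  shows "hausdorff_outer m A + hausdorff_outer m B \<le> hausdorff_outer m (A \<union> B)"
proof -
  have "hausdorff_outer m A + hausdorff_outer m B =
      (SUP \<delta>\<in>{0<..}. hausdorff_pre m \<delta> A + hausdorff_pre m \<delta> B)"
    unfolding hausdorff_outer_def
  proof (rule SUP_add_directed_ennreal[symmetric])
    fix i j :: real assume "i \<in> {0<..}" "j \<in> {0<..}"
    then show "\<exists>k\<in>{0<..}. hausdorff_pre m i A + hausdorff_pre m j B \<le> hausdorff_pre m k A + hausdorff_pre m k B"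
      by (intro bexI[of _ "min i j"] add_mono hausdorff_pre_antimono) auto
  qed
  also have "\<dots> \<le> hausdorff_outer m (A \<union> B)"
  proof (rule SUP_least)
    fix \<delta> :: real assume \<delta>: "\<delta> \<in> {0<..}"
    let ?e = "min \<delta> (d / 2)"
    have "hausdorff_pre m \<delta> A + hausdorff_pre m \<delta> B \<le> hausdorff_pre m ?e A + hausdorff_pre m ?e B"
      by (intro add_mono hausdorff_pre_antimono) auto
    also have "\<dots> \<le> hausdorff_pre m ?e (A \<union> B)"
      using d by (intro hausdorff_pre_separated[OF _ sep]) auto
    also have "\<dots> \<le> hausdorff_outer m (A \<union> B)"
      unfolding hausdorff_outer_def using \<delta> d by (intro SUP_upper) auto
    finally show "hausdorff_pre m \<delta> A + hausdorff_pre m \<delta> B \<le> hausdorff_outer m (A \<union> B)" .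
  qed
  finally show ?thesis .
qed

lemma emeasure_hausdorff:
  fixes S :: "'a::metric_space set"
  assumes "S \<in> sets borel"
  shows "emeasure (hausdorff m) S = hausdorff_outer m S"
proof -
  let ?f = "hausdorff_outer m :: 'a set \<Rightarrow> ennreal"
  let ?L = "lambda_system UNIV (Pow UNIV) ?f"
  interpret P: sigma_algebra UNIV "Pow UNIV :: 'a set set" by (rule sigma_algebra_Pow)
  have "outer_measure_space (Pow UNIV) ?f"
    by (auto simp: outer_measure_space_def positive_def increasing_def countably_subadditive_def
        intro: hausdorff_outer_mono hausdorff_outer_UN)
  then have L: "measure_space UNIV ?L ?f" by (rule P.caratheodory_lemma)
  then interpret L: sigma_algebra UNIV ?L by (simp add: measure_space_def)
  have "closed C \<Longrightarrow> C \<in> ?L" for C :: "'a set"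
    using metric_outer_measure_closed[where f = ?f, OF hausdorff_outer_empty hausdorff_outer_mono
        hausdorff_outer_UN hausdorff_outer_separated]
    by (simp add: P.lambda_system_eq[unfolded Pow_UNIV])
  then have "sigma_sets UNIV (Collect closed) \<subseteq> ?L"
    by (intro L.sigma_sets_subset) auto
  then have sub: "sets borel \<subseteq> ?L" by (simp add: borel_eq_closed)
  have "countably_additive (sets borel) ?f"
    using L sub by (auto simp: measure_space_def countably_additive_def)
  then show ?thesis
    using assms by (intro emeasure_measure_of[OF hausdorff_def]) (auto simp: positive_def)
qed

section \<open>Smooth open sets\<close>

primrec C_k_on :: "nat \<Rightarrow> ('a::euclidean_space \<Rightarrow> real) \<Rightarrow> 'a set \<Rightarrow> bool" where
  "C_k_on 0 f S \<longleftrightarrow> continuous_on S f"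
| "C_k_on (Suc k) f S \<longleftrightarrow> (\<forall>x\<in>S. f differentiable at x) \<and>
     (\<forall>b\<in>Basis. C_k_on k (\<lambda>x. frechet_derivative f (at x) b) S)"

definition smooth_fun_on :: "('a::euclidean_space \<Rightarrow> real) \<Rightarrow> 'a set \<Rightarrow> bool" where
  "smooth_fun_on f S \<longleftrightarrow> (\<forall>k. C_k_on k f S)"

text \<open>An open set with smooth boundary: near each boundary point it is the sublevel set of a
  \<open>C\<^sup>\<infinity>\<close> defining function without critical points. By the implicit function theorem the boundary
  is then a smooth hypersurface and the set lies locally on exactly one side of it. The set
  need be neither bounded nor connected.\<close>

definition smooth_open_set :: "'a::euclidean_space set \<Rightarrow> bool" where
  "smooth_open_set \<Omega> \<longleftrightarrow> open \<Omega> \<and>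
     (\<forall>x\<in>frontier \<Omega>. \<exists>U \<phi>. open U \<and> x \<in> U \<and> smooth_fun_on \<phi> U \<and>
        (\<forall>y\<in>U. frechet_derivative \<phi> (at y) \<noteq> (\<lambda>v. 0)) \<and>
        \<Omega> \<inter> U = {y \<in> U. \<phi> y < 0})"

section \<open>The isoperimetric constant\<close>

text \<open>The case distinction is needed because \<open>0 powr 0 = 0\<close>.\<close>

definition monomial_weight :: "real ^ 'n \<Rightarrow> real ^ 'n \<Rightarrow> real" where
  "monomial_weight A x = (\<Prod>j\<in>UNIV. if A $ j = 0 then 1 else \<bar>x $ j\<bar> powr (A $ j))"

definition weighted_perimeter :: "real ^ 'n \<Rightarrow> (real ^ 'n) set \<Rightarrow> ennreal" where
  "weighted_perimeter A \<Omega> =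
     (\<integral>\<^sup>+x\<in>frontier \<Omega>. ennreal (monomial_weight A x) \<partial>hausdorff (CARD('n) - 1))"

definition weighted_volume :: "real ^ 'n \<Rightarrow> (real ^ 'n) set \<Rightarrow> ennreal" where
  "weighted_volume B \<Omega> = (\<integral>\<^sup>+x\<in>\<Omega>. ennreal (monomial_weight B x) \<partial>lborel)"

text \<open>The quotient takes values in \<open>[0, \<infinity>]\<close>, as the weighted perimeter may be infinite.\<close>

definition isoperimetric_constant :: "real ^ 'n \<Rightarrow> real ^ 'n \<Rightarrow> ennreal" where
  "isoperimetric_constant A B =
     (INF \<Omega> \<in> {\<Omega>. smooth_open_set \<Omega> \<and> 0 < weighted_volume B \<Omega> \<and> weighted_volume B \<Omega> < \<infinity>}.
        weighted_perimeter A \<Omega> /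
        ennreal (enn2real (weighted_volume B \<Omega>) powr
          ((real CARD('n) + (\<Sum>j\<in>UNIV. A $ j) - 1) / (real CARD('n) + (\<Sum>j\<in>UNIV. B $ j)))))"

end

theory Submission
  imports Defs
begin

text \<open>
  The exponents are tuned so that \<open>(N + a - 1) / (N + b) = 1\<close>: the quotient to be minimised is
  simply perimeter over volume. Why its infimum is \<open>a\<^sub>i\<close> can be seen from the vector field
  \<open>F(x) = x\<^sub>i \<bar>x\<^sub>i\<bar> powr b\<^sub>i * (\<Prod>j\<noteq>i. \<bar>x\<^sub>j\<bar> powr b\<^sub>j) e\<^sub>i\<close>. Its divergence is \<open>a\<^sub>i\<close> times the volume
  weight and its length is the perimeter weight, so the divergence theorem gives
  \<open>a\<^sub>i * volume \<le> perimeter\<close>, and the inequality is almost an equality for domains whose boundary is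
  almost orthogonal to \<open>e\<^sub>i\<close>.

  For the lower bound this argument is carried out line by line in direction \<open>e\<^sub>i\<close>. On a half line \<open>r > 0\<close> the measure \<open>a r powr (a - 1) dr\<close> gives \<open>(s, t)\<close>
  the mass \<open>t powr a - s powr a\<close>, so each bounded component of an open set has at most the mass
  \<open>t powr a\<close> of its right endpoint \<open>t\<close>, and distinct components have distinct right endpoints.
  A version of this on a grid (\<open>emeasure_power_measure_open_le\<close>) bounds the volume by a sum over slabs
  of integrals over the projections of the boundary pieces in these slabs. Orthogonal projection does
  not increase \<open>(N-1)\<close>-dimensional Hausdorff measure, so these integrals are at most
  integrals over the boundary itself (\<open>nn_integral_drop_coord_le\<close>). Refining the grid gives
  \<open>volume_le_perimeter\<close>.

  The comparison is sharp only if \<open>(N-1)\<close>-dimensional Hausdorff measure on \<open>\<real>\<^sup>N\<^sup>-\<^sup>1\<close> is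
  exactly Lebesgue measure (\<open>hausdorff_outer_DIM\<close>). One half of this is Vitali's covering theorem.
  The other is the isodiametric inequality: among sets of given diameter a ball has the largest
  volume. It follows from the Prekopa-Leindler inequality applied to a set \<open>S\<close> and its reflection,
  because \<open>(S - S) / 2\<close> lies in a ball of radius \<open>diameter S / 2\<close>.

  For the upper bound, consider the domains
  \<open>\<bar>x\<^sub>i\<bar> < e / (1 + \<bar>x'\<bar>\<^sup>2) ^ K\<close> for \<open>e \<rightarrow> 0\<close>, where \<open>x'\<close> collects the other coordinates. They are smooth,
  their boundary consists of two graphs of functions with Lipschitz constant \<open>e K\<close>, and passing from
  the hyperplane to such a graph increases Hausdorff measure at most by the factor
  \<open>(1 + e K) ^ (N-1)\<close>. Hence the quotient is at most \<open>(1 + e K) ^ (N-1) a\<^sub>i\<close>. A large \<open>K\<close> makes the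
  volume finite.
\<close>

section \<open>The Prekopa-Leindler and isodiametric inequalities\<close>

text \<open>The one-dimensional Brunn-Minkowski inequality, for differences. If \<open>a\<close> is almost the
  supremum of \<open>A\<close> and \<open>b\<close> almost that of \<open>B\<close>, then \<open>A - b\<close> and \<open>a - B\<close> lie
  in \<open>2 C\<close> and overlap only in a tiny interval around \<open>a - b\<close>. Differences take the place of sums
  because the isodiametric inequality compares a set with its own reflection.\<close>

lemma brunn_minkowski_real_bdd_above:
  fixes A B C :: "real set"
  assumes [measurable]: "A \<in> sets borel" "B \<in> sets borel" "C \<in> sets borel"
    and ne: "A \<noteq> {}" "B \<noteq> {}" and bdd: "bdd_above A" "bdd_above B"
    and C: "\<And>a b. a \<in> A \<Longrightarrow> b \<in> B \<Longrightarrow> (a - b) / 2 \<in> C"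
  shows "emeasure lborel A + emeasure lborel B \<le> 2 * emeasure lborel C"
proof (rule ennreal_le_epsilon)
  fix e :: real assume e: "0 < e"
  obtain a where a: "a \<in> A" "Sup A - e / 2 < a"
    using less_cSup_iff[OF ne(1) bdd(1), of "Sup A - e / 2"] e by auto
  obtain b where b: "b \<in> B" "Sup B - e / 2 < b"
    using less_cSup_iff[OF ne(2) bdd(2), of "Sup B - e / 2"] e by auto
  define X where "X = {x. b + 2 * x \<in> A}"
  define Y where "Y = {x. a + (-2) * x \<in> B}"
  have [measurable]: "X \<in> sets borel" "Y \<in> sets borel"
    unfolding X_def Y_def by measurable
  \<comment> \<open>\<open>X\<close> and \<open>Y\<close> are the halved copies of \<open>A - b\<close> and \<open>a - B\<close>.\<close>
  have AX: "emeasure lborel A = 2 * emeasure lborel X"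
    using nn_integral_real_affine[of "indicator A" 2 b]
    by (simp add: X_def flip: nn_integral_indicator)
       (simp add: indicator_def)
  have BY: "emeasure lborel B = 2 * emeasure lborel Y"
    using nn_integral_real_affine[of "indicator B" "-2" a]
    by (simp add: Y_def flip: nn_integral_indicator)
       (simp add: indicator_def)
  have XC: "X \<subseteq> C" using C[OF _ b(1)] by (force simp: X_def)
  have YC: "Y \<subseteq> C" using C[OF a(1)] by (force simp: Y_def)
  have XY: "X \<inter> Y \<subseteq> {(a - Sup B) / 2 .. (Sup A - b) / 2}"
    using cSup_upper[OF _ bdd(1)] cSup_upper[OF _ bdd(2)] by (force simp: X_def Y_def)
  have "emeasure lborel X + emeasure lborel Y = emeasure lborel (X \<union> Y) + emeasure lborel (X \<inter> Y)"
    by (intro emeasure_Un_Int) auto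
  also have "\<dots> \<le> emeasure lborel C + ennreal (e / 2)"
  proof (rule add_mono)
    show "emeasure lborel (X \<union> Y) \<le> emeasure lborel C"
      using XC YC by (intro emeasure_mono) auto
    have "emeasure lborel (X \<inter> Y) \<le> emeasure lborel {(a - Sup B) / 2 .. (Sup A - b) / 2}"
      using XY by (intro emeasure_mono) auto
    also have "\<dots> \<le> ennreal (e / 2)"
    proof -
      have "(Sup A - b) / 2 - (a - Sup B) / 2 \<le> e / 2"
        using a b by (simp add: field_simps)
      then show ?thesis using e by (auto simp: emeasure_lborel_Icc_eq intro!: ennreal_leI)
    qed
    finally show "emeasure lborel (X \<inter> Y) \<le> ennreal (e / 2)" .
  qed
  finally have "2 * (emeasure lborel X + emeasure lborel Y) \<le> 2 * (emeasure lborel C + ennreal (e / 2))"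
    by (intro mult_left_mono) auto
  also have "2 * (emeasure lborel C + ennreal (e / 2)) = 2 * emeasure lborel C + ennreal e"
    using e ennreal_mult'[of 2 "e/2"] by (simp add: distrib_left)
  finally show "emeasure lborel A + emeasure lborel B \<le> 2 * emeasure lborel C + ennreal e"
    unfolding AX BY by (simp add: distrib_left)
qed

lemma brunn_minkowski_real:
  fixes A B C :: "real set"
  assumes [measurable]: "A \<in> sets borel" "B \<in> sets borel" "C \<in> sets borel"
    and ne: "A \<noteq> {}" "B \<noteq> {}"
    and C: "\<And>a b. a \<in> A \<Longrightarrow> b \<in> B \<Longrightarrow> (a - b) / 2 \<in> C"
  shows "emeasure lborel A + emeasure lborel B \<le> 2 * emeasure lborel C"
proof -
  have lim: "(\<lambda>n. emeasure lborel (S \<inter> {..real n})) \<longlonglongrightarrow> emeasure lborel S"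
    if [measurable]: "S \<in> sets borel" for S
  proof -
    have "(\<lambda>n. emeasure lborel (S \<inter> {..real n})) \<longlonglongrightarrow> emeasure lborel (\<Union>n. S \<inter> {..real n})"
      by (intro Lim_emeasure_incseq) (auto simp: incseq_def)
    also have "(\<Union>n. S \<inter> {..real n}) = S"
      using real_arch_simple by auto
    finally show ?thesis .
  qed
  obtain a b where ab: "a \<in> A" "b \<in> B" using ne by auto
  show ?thesis
  proof (rule LIMSEQ_le_const2[OF tendsto_add[OF lim lim]])
    obtain N where N: "max a b \<le> real N" using real_arch_simple by blast
    show "\<exists>N. \<forall>n\<ge>N. emeasure lborel (A \<inter> {..real n}) + emeasure lborel (B \<inter> {..real n})
        \<le> 2 * emeasure lborel C"
    proof (intro exI allI impI)
      fix n assume "n \<ge> N"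
      then have "max a b \<le> real n" using N by linarith
      then have "A \<inter> {..real n} \<noteq> {}" "B \<inter> {..real n} \<noteq> {}" using ab by auto
      then show "emeasure lborel (A \<inter> {..real n}) + emeasure lborel (B \<inter> {..real n})
        \<le> 2 * emeasure lborel C"
        using C by (intro brunn_minkowski_real_bdd_above) auto
    qed
  qed auto
qed

lemma nn_integral_layer_cake:
  fixes f :: "real \<Rightarrow> ennreal"
  assumes [measurable]: "f \<in> borel_measurable borel"
  shows "(\<integral>\<^sup>+x. f x \<partial>lborel)
    = (\<integral>\<^sup>+l. indicator {0..} l * emeasure lborel {x. ennreal l < f x} \<partial>lborel)"
proof -
  have *: "f x = (\<integral>\<^sup>+l. indicator {0..} l * indicator {x. ennreal l < f x} x \<partial>lborel)" for x
  proof (cases "f x")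
    case (real r)
    have "(\<integral>\<^sup>+l. indicator {0..} l * indicator {x. ennreal l < f x} x \<partial>lborel)
        = (\<integral>\<^sup>+l. indicator {0..<r} l \<partial>lborel)"
      using real by (intro nn_integral_cong) (auto simp: indicator_def ennreal_less_iff)
    then show ?thesis using real by simp
  next
    case top
    have "(\<integral>\<^sup>+l. indicator {0..} l * indicator {x. ennreal l < f x} x \<partial>lborel)
        = (\<integral>\<^sup>+l. indicator {0::real..} l \<partial>lborel)"
      using top by (intro nn_integral_cong) (auto simp: indicator_def)
    also have "\<dots> = emeasure lborel {0::real..}" by simp
    also have "\<dots> = \<infinity>"
    proof -
      have "of_nat n \<le> emeasure lborel {0::real..}" for n :: nat
      proof -
        have "of_nat n = emeasure lborel {0..real n}" by (simp add: ennreal_of_nat_eq_real_of_nat)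
        also have "\<dots> \<le> emeasure lborel {0::real..}" by (intro emeasure_mono) auto
        finally show ?thesis .
      qed
      then show ?thesis
        using ennreal_Ex_less_of_nat[of "emeasure lborel {0::real..}"]
        by (auto simp: less_top[symmetric] dest: leD)
    qed
    finally show ?thesis using top by simp
  qed
  have "(\<integral>\<^sup>+x. f x \<partial>lborel)
    = (\<integral>\<^sup>+x. \<integral>\<^sup>+l. indicator {0..} l * indicator {x. ennreal l < f x} x \<partial>lborel \<partial>lborel)"
    by (subst *) simp
  also have "\<dots> = (\<integral>\<^sup>+l. \<integral>\<^sup>+x. indicator {0..} l * indicator {x. ennreal l < f x} x \<partial>lborel \<partial>lborel)"
    by (rule lborel_pair.Fubini') measurable
  also have "\<dots> = (\<integral>\<^sup>+l. indicator {0..} l * emeasure lborel {x. ennreal l < f x} \<partial>lborel)"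
    by (intro nn_integral_cong) (simp add: nn_integral_cmult)
  finally show ?thesis .
qed

lemma ennreal_mult_le_square_of_add_le:
  fixes u v w :: ennreal
  assumes "u + v \<le> 2 * w"
  shows "u * v \<le> w\<^sup>2"
proof (cases w)
  case (real r)
  have "u + v < top"
    using le_less_trans[OF assms, of top] real by (simp add: ennreal_mult_less_top)
  then have "u < top" "v < top" by auto
  then obtain a b where ab: "u = ennreal a" "v = ennreal b" "0 \<le> a" "0 \<le> b"
    by (metis ennreal_cases less_top)
  have "2 * w = ennreal (2 * r)" using real by (simp add: ennreal_mult')
  then have "a + b \<le> 2 * r"
    using assms ab real by (simp add: ennreal_plus[symmetric] del: ennreal_plus)
  then have "(a + b)\<^sup>2 \<le> (2 * r)\<^sup>2" using ab by (intro power_mono) auto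
  moreover have "4 * (a * b) \<le> (a + b)\<^sup>2" 
    using zero_le_power2[of "a - b"] by (simp add: power2_eq_square algebra_simps)
  ultimately have "a * b \<le> r\<^sup>2" by (simp add: power_mult_distrib)
  then show ?thesis using ab real
    by (simp add: ennreal_mult[symmetric] ennreal_power)
next
  case top
  then show ?thesis by (simp add: power2_eq_square)
qed

lemma ennreal_square_less_mult:
  fixes a b c :: ennreal
  assumes "c < a" "c < b"
  shows "c * c < a * b"
proof (cases "c = 0")
  case True
  then show ?thesis using assms by (simp add: ennreal_zero_less_mult_iff)
next
  case False
  then have "c * c < a * c"
    using assms by (intro ennreal_mult_strict_right_mono)
      (auto simp: zero_less_iff_neq_zero intro: less_le_trans)
  also have "\<dots> \<le> a * b" using assms by (intro mult_left_mono) auto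
  finally show ?thesis .
qed

text \<open>With both suprema equal to \<open>1\<close>, the superlevel sets of \<open>f\<close> and \<open>g\<close> at every level below \<open>1\<close> are
  nonempty, so that the Brunn-Minkowski inequality applies at each level; integrating over the levels
  gives the arithmetic mean of the two integrals as a lower bound for the integral of \<open>h\<close>. This is
  stronger than the bound by the geometric mean, but it depends on the normalisation.\<close>

lemma prekopa_leindler_real_normalised:
  fixes f g h :: "real \<Rightarrow> ennreal"
  assumes [measurable]: "f \<in> borel_measurable borel" "g \<in> borel_measurable borel"
      "h \<in> borel_measurable borel"
    and f: "(SUP s. f s) = 1" and g: "(SUP t. g t) = 1"
    and h: "\<And>s t. f s * g t \<le> (h ((s - t) / 2))\<^sup>2"
  shows "(\<integral>\<^sup>+x. f x \<partial>lborel) + (\<integral>\<^sup>+x. g x \<partial>lborel) \<le> 2 * (\<integral>\<^sup>+x. h x \<partial>lborel)"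
proof -
  let ?I = "indicator {0..} :: real \<Rightarrow> ennreal"
  have level: "emeasure lborel {x. ennreal l < f x} + emeasure lborel {x. ennreal l < g x}
      \<le> 2 * emeasure lborel {x. ennreal l < h x}" if l: "0 \<le> l" for l
  proof (cases "l < 1")
    case True
    then have l1: "ennreal l < 1" by (simp add: l ennreal_less_iff flip: ennreal_1)
    obtain s t where st: "ennreal l < f s" "ennreal l < g t"
      using l1 f g by (metis less_SUP_iff)
    show ?thesis
    proof (rule brunn_minkowski_real)
      fix a b assume ab: "a \<in> {x. ennreal l < f x}" "b \<in> {x. ennreal l < g x}"
      show "(a - b) / 2 \<in> {x. ennreal l < h x}"
      proof (rule ccontr)
        assume "\<not> ?thesis"
        then have "h ((a - b) / 2) \<le> ennreal l" by simp
        then have "(h ((a - b) / 2))\<^sup>2 \<le> (ennreal l)\<^sup>2" by (intro power_mono) auto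
        also have "\<dots> < f a * g b"
          using ab by (auto simp: power2_eq_square intro: ennreal_square_less_mult)
        finally show False using h[of a b] by simp
      qed
    qed (use st in auto)
  next
    case False
    have "f x \<le> 1" "g x \<le> 1" for x using f g SUP_upper[of x UNIV f] SUP_upper[of x UNIV g] by auto
    moreover have "1 \<le> ennreal l" using False by simp
    ultimately have "\<not> ennreal l < f x" "\<not> ennreal l < g x" for x
      by (meson leD le_less_trans)+
    then show ?thesis by simp
  qed
  have "(\<integral>\<^sup>+x. f x \<partial>lborel) + (\<integral>\<^sup>+x. g x \<partial>lborel) =
     (\<integral>\<^sup>+l. ?I l * emeasure lborel {x. ennreal l < f x} + ?I l * emeasure lborel {x. ennreal l < g x} \<partial>lborel)"
    unfolding nn_integral_layer_cake[OF assms(1)] nn_integral_layer_cake[OF assms(2)]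
    by (intro nn_integral_add[symmetric]) measurable
  also have "\<dots> \<le> (\<integral>\<^sup>+l. 2 * (?I l * emeasure lborel {x. ennreal l < h x}) \<partial>lborel)"
    by (intro nn_integral_mono) (auto simp: indicator_def level)
  also have "\<dots> = 2 * (\<integral>\<^sup>+x. h x \<partial>lborel)"
    unfolding nn_integral_layer_cake[OF assms(3)] by (intro nn_integral_cmult) measurable
  finally show ?thesis .
qed

lemma prekopa_leindler_real_bounded:
  fixes f g h :: "real \<Rightarrow> ennreal"
  assumes [measurable]: "f \<in> borel_measurable borel" "g \<in> borel_measurable borel"
      "h \<in> borel_measurable borel"
    and f: "(SUP s. f s) \<noteq> top" and g: "(SUP t. g t) \<noteq> top"
    and h: "\<And>s t. f s * g t \<le> (h ((s - t) / 2))\<^sup>2"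
  shows "(\<integral>\<^sup>+x. f x \<partial>lborel) * (\<integral>\<^sup>+x. g x \<partial>lborel) \<le> (\<integral>\<^sup>+x. h x \<partial>lborel)\<^sup>2"
proof -
  obtain a where a: "(SUP s. f s) = ennreal a" "0 \<le> a" using f by (cases "SUP s. f s") auto
  obtain b where b: "(SUP s. g s) = ennreal b" "0 \<le> b" using g by (cases "SUP s. g s") auto
  have fa: "f s \<le> ennreal a" and gb: "g s \<le> ennreal b" for s
    using a b SUP_upper[of s UNIV f] SUP_upper[of s UNIV g] by auto
  show ?thesis
  proof (cases "a = 0 \<or> b = 0")
    case True
    then have "(\<forall>s. f s = 0) \<or> (\<forall>s. g s = 0)" using fa gb by auto
    then show ?thesis by auto
  next
    case False
    with a b have pos: "a > 0" "b > 0" by auto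
    \<comment> \<open>Dividing \<open>h\<close> by the geometric mean of the two suprema preserves the hypothesis on \<open>f\<close>, \<open>g\<close>, \<open>h\<close>.\<close>
    define c where "c = sqrt (a * b)"
    have c: "c > 0" "c * c = a * b" using pos by (auto simp: c_def)
    have inv: "ennreal (1 / r) * ennreal r = 1" if "r > 0" for r
      using that by (simp flip: ennreal_mult')
    let ?F = "\<integral>\<^sup>+x. f x \<partial>lborel" and ?G = "\<integral>\<^sup>+x. g x \<partial>lborel" and ?H = "\<integral>\<^sup>+x. h x \<partial>lborel"
    have "(\<integral>\<^sup>+x. ennreal (1 / a) * f x \<partial>lborel) + (\<integral>\<^sup>+x. ennreal (1 / b) * g x \<partial>lborel)
        \<le> 2 * (\<integral>\<^sup>+x. ennreal (1 / c) * h x \<partial>lborel)"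
    proof (rule prekopa_leindler_real_normalised)
      show "(SUP s. ennreal (1 / a) * f s) = 1" "(SUP s. ennreal (1 / b) * g s) = 1"
        using a b inv pos by (simp_all add: SUP_mult_left_ennreal[symmetric])
      fix s t
      have "(ennreal (1 / a) * f s) * (ennreal (1 / b) * g t)
          = ennreal (1 / (a * b)) * (f s * g t)"
      proof -
        have "ennreal (1 / (a * b)) = ennreal (1 / a) * ennreal (1 / b)"
          using pos by (simp flip: ennreal_mult')
        then show ?thesis by (simp only: mult_ac)
      qed
      also have "\<dots> \<le> ennreal (1 / (a * b)) * (h ((s - t) / 2))\<^sup>2"
        by (intro mult_left_mono h) auto
      also have "ennreal (1 / (a * b)) = (ennreal (1 / c))\<^sup>2"
        using c by (simp add: power2_eq_square flip: ennreal_mult')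
      finally show "(ennreal (1 / a) * f s) * (ennreal (1 / b) * g t) \<le> (ennreal (1 / c) * h ((s - t) / 2))\<^sup>2"
        by (simp add: power_mult_distrib)
    qed auto
    then have "(ennreal (1 / a) * ?F) + (ennreal (1 / b) * ?G) \<le> 2 * (ennreal (1 / c) * ?H)"
      by (simp add: nn_integral_cmult)
    then have "(ennreal (1 / a) * ?F) * (ennreal (1 / b) * ?G) \<le> (ennreal (1 / c) * ?H)\<^sup>2"
      by (rule ennreal_mult_le_square_of_add_le)
    then have "(ennreal c * ennreal c) * ((ennreal (1 / a) * ?F) * (ennreal (1 / b) * ?G)) \<le> (ennreal c * ennreal c) * (ennreal (1 / c) * ?H)\<^sup>2"
      by (rule mult_left_mono) simp
    moreover have "ennreal c * ennreal c = ennreal a * ennreal b"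
      using c pos by (simp flip: ennreal_mult')
    then have "(ennreal c * ennreal c) * ((ennreal (1 / a) * ?F) * (ennreal (1 / b) * ?G))
       = (ennreal (1 / a) * ennreal a) * (ennreal (1 / b) * ennreal b) * (?F * ?G)"
      by (simp only: ac_simps)
    moreover have "(ennreal c * ennreal c) * (ennreal (1 / c) * ?H)\<^sup>2
       = (ennreal (1 / c) * ennreal c) * (ennreal (1 / c) * ennreal c) * ?H\<^sup>2"
      by (simp only: ac_simps power2_eq_square)
    ultimately show ?thesis using inv pos c by simp
  qed
qed

lemma nn_integral_SUP_truncate:
  fixes f :: "'a \<Rightarrow> ennreal"
  assumes [measurable]: "f \<in> borel_measurable M"
  shows "(\<integral>\<^sup>+x. f x \<partial>M) = (SUP n. \<integral>\<^sup>+x. min (f x) (of_nat n) \<partial>M)"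
proof -
  have "f x = (SUP n. min (f x) (of_nat n))" for x
  proof (rule antisym)
    show "f x \<le> (SUP n. min (f x) (of_nat n))"
    proof (cases "f x = top")
      case True
      then show ?thesis by (simp add: ennreal_SUP_of_nat_eq_top)
    next
      case False
      then obtain n :: nat where "f x < of_nat n"
        using ennreal_Ex_less_of_nat[of "f x"] by (auto simp: less_top)
      then show ?thesis by (intro SUP_upper2[of n]) auto
    qed
  qed (auto intro!: SUP_least)
  then have "(\<integral>\<^sup>+x. f x \<partial>M) = (\<integral>\<^sup>+x. (SUP n. min (f x) (of_nat n)) \<partial>M)"
    by (intro nn_integral_cong) simp
  also have "\<dots> = (SUP n. \<integral>\<^sup>+x. min (f x) (of_nat n) \<partial>M)"
    by (intro nn_integral_monotone_convergence_SUP)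
       (auto simp: incseq_def le_fun_def intro: min.coboundedI2)
  finally show ?thesis .
qed

text \<open>The two functions are truncated at independent heights, so that the limit of the
  product can be taken in one factor at a time.\<close>

lemma prekopa_leindler_real:
  fixes f g h :: "real \<Rightarrow> ennreal"
  assumes [measurable]: "f \<in> borel_measurable borel" "g \<in> borel_measurable borel"
      "h \<in> borel_measurable borel"
    and h: "\<And>s t. f s * g t \<le> (h ((s - t) / 2))\<^sup>2"
  shows "(\<integral>\<^sup>+x. f x \<partial>lborel) * (\<integral>\<^sup>+x. g x \<partial>lborel) \<le> (\<integral>\<^sup>+x. h x \<partial>lborel)\<^sup>2"
proof -
  have *: "(\<integral>\<^sup>+x. min (f x) (of_nat m) \<partial>lborel) * (\<integral>\<^sup>+x. min (g x) (of_nat n) \<partial>lborel)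
      \<le> (\<integral>\<^sup>+x. h x \<partial>lborel)\<^sup>2" for m n :: nat
  proof (rule prekopa_leindler_real_bounded)
    have "(SUP s. min (f s) (of_nat m)) \<le> of_nat m" "(SUP s. min (g s) (of_nat n)) \<le> of_nat n"
      by (auto intro: SUP_least)
    then show "(SUP s. min (f s) (of_nat m)) \<noteq> top" "(SUP s. min (g s) (of_nat n)) \<noteq> top"
      by (metis ennreal_of_nat_neq_top top_unique)+
    show "min (f s) (of_nat m) * min (g t) (of_nat n) \<le> (h ((s - t) / 2))\<^sup>2" for s t
      by (rule order_trans[OF _ h[of s t]]) (intro mult_mono, auto)
  qed auto
  then show ?thesis
    unfolding nn_integral_SUP_truncate[of f lborel, simplified] nn_integral_SUP_truncate[of g lborel, simplified]
    by (simp add: SUP_mult_left_ennreal SUP_mult_right_ennreal SUP_least)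
qed

text \<open>Fibre integrals over all but one coordinate satisfy the hypothesis of the
  one-dimensional inequality by the induction hypothesis. This is why the functional form is proved
  instead of the Brunn-Minkowski inequality for sets, which is not stable under such an induction.\<close>

lemma prekopa_leindler_PiM:
  fixes f g h :: "('i \<Rightarrow> real) \<Rightarrow> ennreal"
  assumes "finite I"
    and "f \<in> borel_measurable (Pi\<^sub>M I (\<lambda>_. lborel))" "g \<in> borel_measurable (Pi\<^sub>M I (\<lambda>_. lborel))"
      "h \<in> borel_measurable (Pi\<^sub>M I (\<lambda>_. lborel))"
    and "\<And>x y. x \<in> extensional I \<Longrightarrow> y \<in> extensional I \<Longrightarrow>
      f x * g y \<le> (h (\<lambda>i\<in>I. (x i - y i) / 2))\<^sup>2"
  shows "(\<integral>\<^sup>+x. f x \<partial>Pi\<^sub>M I (\<lambda>_. lborel)) * (\<integral>\<^sup>+x. g x \<partial>Pi\<^sub>M I (\<lambda>_. lborel))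
    \<le> (\<integral>\<^sup>+x. h x \<partial>Pi\<^sub>M I (\<lambda>_. lborel))\<^sup>2"
  using assms
proof (induction I arbitrary: f g h rule: finite_induct)
  case empty
  interpret product_sigma_finite "\<lambda>_. lborel :: real measure" by standard
  have "(\<lambda>i\<in>{}. (x i - y i) / 2) = (\<lambda>_. undefined)" for x y :: "'i \<Rightarrow> real" by (auto simp: restrict_def)
  then show ?case using empty(4)[of "\<lambda>_. undefined" "\<lambda>_. undefined"]
    by (simp add: PiM_empty nn_integral_count_space_finite)
next
  case (insert i I)
  interpret product_sigma_finite "\<lambda>_. lborel :: real measure" by standard
  interpret I: finite_product_sigma_finite "\<lambda>_. lborel :: real measure" I by standard fact
  note [measurable] = insert.prems(1-3)
  let ?P = "Pi\<^sub>M I (\<lambda>_. lborel :: real measure)"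
  show ?case
    unfolding product_nn_integral_insert_rev[OF insert(1,2) insert.prems(1)]
      product_nn_integral_insert_rev[OF insert(1,2) insert.prems(2)]
      product_nn_integral_insert_rev[OF insert(1,2) insert.prems(3)]
  proof (rule prekopa_leindler_real)
    have meas: "(\<lambda>s. \<integral>\<^sup>+x. u (x(i := s)) \<partial>?P) \<in> borel_measurable borel"
      if [measurable]: "u \<in> borel_measurable (Pi\<^sub>M (insert i I) (\<lambda>_. lborel))" for u :: "('i \<Rightarrow> real) \<Rightarrow> ennreal"
    proof -
      have "(\<lambda>s. \<integral>\<^sup>+x. u (x(i := s)) \<partial>?P) \<in> borel_measurable lborel"
        by (rule I.borel_measurable_nn_integral) measurable
      then show ?thesis by simp
    qed
    show "(\<lambda>s. \<integral>\<^sup>+x. f (x(i := s)) \<partial>?P) \<in> borel_measurable borel"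
      "(\<lambda>s. \<integral>\<^sup>+x. g (x(i := s)) \<partial>?P) \<in> borel_measurable borel"
      "(\<lambda>s. \<integral>\<^sup>+x. h (x(i := s)) \<partial>?P) \<in> borel_measurable borel"
      by (rule meas; fact)+
    fix s t
    have upd: "(\<lambda>x. u (x(i := r))) \<in> borel_measurable ?P"
      if [measurable]: "u \<in> borel_measurable (Pi\<^sub>M (insert i I) (\<lambda>_. lborel))" for u :: "('i \<Rightarrow> real) \<Rightarrow> ennreal" and r
      by measurable
    show "(\<integral>\<^sup>+x. f (x(i := s)) \<partial>?P) * (\<integral>\<^sup>+x. g (x(i := t)) \<partial>?P)
        \<le> (\<integral>\<^sup>+x. h (x(i := (s - t) / 2)) \<partial>?P)\<^sup>2"
    proof (rule insert.IH)
      fix x y :: "'i \<Rightarrow> real" assume "x \<in> extensional I" "y \<in> extensional I"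
      then have "x(i := s) \<in> extensional (insert i I)" "y(i := t) \<in> extensional (insert i I)"
        by (auto simp: extensional_def)
      from insert.prems(4)[OF this]
      have "f (x(i := s)) * g (y(i := t)) \<le> (h (\<lambda>j\<in>insert i I. ((x(i := s)) j - (y(i := t)) j) / 2))\<^sup>2" .
      also have "(\<lambda>j\<in>insert i I. ((x(i := s)) j - (y(i := t)) j) / 2)
          = (\<lambda>j\<in>I. (x j - y j) / 2)(i := (s - t) / 2)"
        using insert(2) by (auto simp: restrict_def fun_eq_iff)
      finally show "f (x(i := s)) * g (y(i := t)) \<le> (h ((\<lambda>j\<in>I. (x j - y j) / 2)(i := (s - t) / 2)))\<^sup>2" .
    qed (rule upd; fact)+
  qed
qed

theorem prekopa_leindler:
  fixes f g h :: "'a::euclidean_space \<Rightarrow> ennreal"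
  assumes [measurable]: "f \<in> borel_measurable borel" "g \<in> borel_measurable borel"
      "h \<in> borel_measurable borel"
    and h: "\<And>x y. f x * g y \<le> (h ((x - y) /\<^sub>R 2))\<^sup>2"
  shows "(\<integral>\<^sup>+x. f x \<partial>lborel) * (\<integral>\<^sup>+x. g x \<partial>lborel) \<le> (\<integral>\<^sup>+x. h x \<partial>lborel)\<^sup>2"
proof -
  let ?T = "\<lambda>x. \<Sum>b\<in>Basis. x b *\<^sub>R b :: 'a"
  have T [measurable]: "?T \<in> borel_measurable (Pi\<^sub>M Basis (\<lambda>_. lborel))"
    by (intro borel_measurable_sum borel_measurable_scaleR borel_measurable_const)
       (use measurable_component_singleton[of _ Basis "\<lambda>_. lborel :: real measure"] in simp)
  have eq: "(\<integral>\<^sup>+x. u x \<partial>lborel) = (\<integral>\<^sup>+x. u (?T x) \<partial>Pi\<^sub>M Basis (\<lambda>_. lborel))"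
    if [measurable]: "u \<in> borel_measurable borel" for u :: "'a \<Rightarrow> ennreal"
    by (subst lborel_eq) (rule nn_integral_distr[OF T], simp)
  show ?thesis
    unfolding eq[OF assms(1)] eq[OF assms(2)] eq[OF assms(3)]
  proof (rule prekopa_leindler_PiM)
    fix x y :: "'a \<Rightarrow> real"
    have "?T (\<lambda>i\<in>Basis. (x i - y i) / 2) = (?T x - ?T y) /\<^sub>R 2"
      unfolding sum_subtractf[symmetric] scaleR_sum_right
      by (rule sum.cong) (auto simp: scaleR_diff_left diff_divide_distrib scaleR_diff_right)
    then show "f (?T x) * g (?T y) \<le> (h (?T (\<lambda>i\<in>Basis. (x i - y i) / 2)))\<^sup>2"
      using h[of "?T x" "?T y"] by simp
  qed (auto intro: measurable_compose[OF T assms(1)] measurable_compose[OF T assms(2)]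
    measurable_compose[OF T assms(3)])
qed

text \<open>The inequality is applied to the indicator functions of \<open>S\<close>, \<open>S\<close> and the centred ball of
  radius \<open>diameter S / 2\<close>, which contains every half difference of points of \<open>S\<close>.\<close>

theorem isodiametric:
  fixes S :: "'a::euclidean_space set"
  assumes [measurable]: "S \<in> sets borel" and S: "bounded S" "S \<noteq> {}"
  shows "emeasure lborel S \<le> ennreal (unit_ball_vol (real DIM('a)) * (diameter S / 2) ^ DIM('a))"
proof -
  let ?B = "cball (0::'a) (diameter S / 2)"
  have "(\<integral>\<^sup>+x. indicator S x \<partial>lborel) * (\<integral>\<^sup>+x. indicator S x \<partial>lborel) \<le> (\<integral>\<^sup>+x. indicator ?B x \<partial>lborel)\<^sup>2"
  proof (rule prekopa_leindler)
    fix x y :: 'a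
    show "indicator S x * indicator S y \<le> (indicator ?B ((x - y) /\<^sub>R 2) :: ennreal)\<^sup>2"
      using diameter_bounded_bound[OF S(1), of x y]
      by (auto simp: indicator_def dist_norm)
  qed (auto intro!: borel_measurable_indicator)
  then have "(emeasure lborel S)\<^sup>2 \<le> (emeasure lborel ?B)\<^sup>2" by (simp add: power2_eq_square)
  then have "emeasure lborel S \<le> emeasure lborel ?B"
    using ennreal_square_less_mult[of "emeasure lborel ?B" "emeasure lborel S" "emeasure lborel S"]
    by (auto simp: power2_eq_square not_le[symmetric])
  then show ?thesis
    using diameter_ge_0[OF S(1)] by (simp add: emeasure_cball)
qed

section \<open>Hausdorff measure of full dimension\<close>

lemma hausdorff_pre_le_countable_cover:
  fixes U :: "'i \<Rightarrow> 'a::metric_space set"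
  assumes C: "countable C" and cov: "S \<subseteq> (\<Union>i\<in>C. U i)" and "0 < \<delta>"
    and U: "\<And>i. i \<in> C \<Longrightarrow> bounded (U i) \<and> diameter (U i) \<le> \<delta>"
  shows "hausdorff_pre m \<delta> S \<le> (\<integral>\<^sup>+i. hausdorff_gauge m (U i) \<partial>count_space C)"
proof -
  define N where "N = to_nat_on C ` C"
  define W where "W n = (if n \<in> N then U (from_nat_into C n) else {})" for n
  have bij: "bij_betw (to_nat_on C) C N"
    using C by (simp add: N_def bij_betw_def inj_on_to_nat_on)
  have "hausdorff_pre m \<delta> S \<le> (\<Sum>n. hausdorff_gauge m (W n))"
    unfolding hausdorff_pre_def
  proof (rule INF_lower, safe)
    fix x assume "x \<in> S"
    then obtain i where i: "i \<in> C" "x \<in> U i" using cov by auto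
    then have "x \<in> W (to_nat_on C i)" using C by (simp add: W_def N_def)
    then show "x \<in> (\<Union>n. W n)" by blast
  next
    fix n
    show "bounded (W n)" "diameter (W n) \<le> \<delta>"
      using U C \<open>0 < \<delta>\<close> by (auto simp: W_def N_def)
  qed
  also have "\<dots> = (\<integral>\<^sup>+n. hausdorff_gauge m (W n) \<partial>count_space UNIV)"
    by (rule nn_integral_count_space_nat[symmetric])
  also have "\<dots> = (\<integral>\<^sup>+n. hausdorff_gauge m (W n) \<partial>count_space N)"
    by (rule nn_integral_count_space_eq) (auto simp: W_def)
  also have "\<dots> = (\<integral>\<^sup>+i. hausdorff_gauge m (W (to_nat_on C i)) \<partial>count_space C)"
    by (rule nn_integral_bij_count_space[OF bij, symmetric])
  also have "\<dots> = (\<integral>\<^sup>+i. hausdorff_gauge m (U i) \<partial>count_space C)"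
    using C by (intro nn_integral_cong) (simp add: W_def N_def)
  finally show ?thesis .
qed

lemma hausdorff_gauge_cball:
  fixes x :: "'a::euclidean_space"
  assumes "0 \<le> r"
  shows "hausdorff_gauge DIM('a) (cball x r) = emeasure lborel (cball x r)"
  using assms by (simp add: hausdorff_gauge_def emeasure_cball)

text \<open>A crude bound with the wrong constant, from the covering lemma with balls enlarged by the factor
  \<open>5\<close>. It serves only to show that Lebesgue null sets have Hausdorff measure zero.\<close>

lemma hausdorff_pre_open_le:
  fixes T :: "'a::euclidean_space set"
  assumes T: "open T" and \<delta>: "0 < \<delta>"
  shows "hausdorff_pre DIM('a) \<delta> T \<le> ennreal (5 ^ DIM('a)) * emeasure lborel T"
proof -
  define K where "K = {(x::'a, r::real). 0 < r \<and> r \<le> \<delta> / 10 \<and> cball x r \<subseteq> T}"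
  have "T \<subseteq> (\<Union>i\<in>K. cball (fst i) (snd i))"
  proof
    fix x assume "x \<in> T"
    then obtain r where r: "r > 0" "cball x r \<subseteq> T" using T open_contains_cball by blast
    then have "cball x (min r (\<delta> / 10)) \<subseteq> T" by (auto intro: order_trans[rotated])
    then have "(x, min r (\<delta> / 10)) \<in> K" using r \<delta> by (auto simp: K_def)
    then show "x \<in> (\<Union>i\<in>K. cball (fst i) (snd i))" using r \<delta> by force
  qed
  moreover have "\<And>i. i \<in> K \<Longrightarrow> 0 < snd i \<and> snd i \<le> \<delta> / 10" by (auto simp: K_def)
  ultimately obtain C where C: "countable C" "C \<subseteq> K"
    "pairwise (\<lambda>i j. disjnt (cball (fst i) (snd i)) (cball (fst j) (snd j))) C"
    "T \<subseteq> (\<Union>i\<in>C. cball (fst i) (5 * snd i))"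
    by (rule Vitali_covering_lemma_cballs)
  have K: "0 < snd i" "snd i \<le> \<delta> / 10" "cball (fst i) (snd i) \<subseteq> T" if "i \<in> C" for i
    using that C(2) by (cases i; auto simp: K_def subset_eq)+
  have disj: "disjoint_family_on (\<lambda>i. cball (fst i) (snd i)) C"
    using C(3) by (auto simp: disjoint_family_on_def pairwise_def disjnt_def)
  have "hausdorff_pre DIM('a) \<delta> T
      \<le> (\<integral>\<^sup>+i. hausdorff_gauge DIM('a) (cball (fst i) (5 * snd i)) \<partial>count_space C)"
    using K by (intro hausdorff_pre_le_countable_cover C \<delta>) fastforce
  also have "\<dots> = (\<integral>\<^sup>+i. ennreal (5 ^ DIM('a)) * emeasure lborel (cball (fst i) (snd i)) \<partial>count_space C)"
  proof (intro nn_integral_cong)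
    fix i assume "i \<in> space (count_space C)"
    then have "0 < snd i" using K by simp
    then show "hausdorff_gauge DIM('a) (cball (fst i) (5 * snd i))
        = ennreal (5 ^ DIM('a)) * emeasure lborel (cball (fst i) (snd i))"
      by (simp add: hausdorff_gauge_cball emeasure_cball power_mult_distrib ac_simps flip: ennreal_mult)
  qed
  also have "\<dots> = ennreal (5 ^ DIM('a)) * emeasure lborel (\<Union>i\<in>C. cball (fst i) (snd i))"
    using C(1) disj by (simp add: nn_integral_cmult emeasure_UN_countable)
  also have "\<dots> \<le> ennreal (5 ^ DIM('a)) * emeasure lborel T"
    using T by (intro mult_left_mono emeasure_mono UN_least K(3)) auto
  finally show ?thesis .
qed

lemma hausdorff_pre_null:
  fixes N :: "'a::euclidean_space set"
  assumes [measurable]: "N \<in> sets borel" and N: "emeasure lborel N = 0" and \<delta>: "0 < \<delta>"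
  shows "hausdorff_pre DIM('a) \<delta> N = 0"
proof -
  have *: "hausdorff_pre DIM('a) \<delta> N \<le> 0 + ennreal e" if e: "0 < e" for e
  proof -
    obtain U where U: "open U" "N \<subseteq> U" "emeasure lborel (U - N) < ennreal (e / 5 ^ DIM('a))"
      using outer_regular_lborel[of N "e / 5 ^ DIM('a)"] e by auto
    have [measurable]: "U \<in> sets borel" using U by auto
    have "emeasure lborel U = emeasure lborel (U - N)"
      using U(2) N by (subst emeasure_Diff_null_set) auto
    with U have U': "emeasure lborel U \<le> ennreal (e / 5 ^ DIM('a))" by simp
    have "hausdorff_pre DIM('a) \<delta> N \<le> hausdorff_pre DIM('a) \<delta> U"
      using U by (intro hausdorff_pre_mono)
    also have "\<dots> \<le> ennreal (5 ^ DIM('a)) * emeasure lborel U"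
      by (rule hausdorff_pre_open_le[OF U(1) \<delta>])
    also have "\<dots> \<le> ennreal (5 ^ DIM('a)) * ennreal (e / 5 ^ DIM('a))"
      by (intro mult_left_mono U') auto
    also have "\<dots> = ennreal e" using e by (simp flip: ennreal_mult)
    finally show ?thesis by simp
  qed
  have "hausdorff_pre DIM('a) \<delta> N \<le> 0" by (rule ennreal_le_epsilon) (rule *)
  then show ?thesis by simp
qed

lemma hausdorff_pre_Un:
  assumes "0 < \<delta>"
  shows "hausdorff_pre m \<delta> (A \<union> B) \<le> hausdorff_pre m \<delta> A + hausdorff_pre m \<delta> B"
proof -
  have "hausdorff_pre m \<delta> (\<Union>i. binaryset A B i) \<le> (\<Sum>i. hausdorff_pre m \<delta> (binaryset A B i))"
    by (rule hausdorff_pre_UN)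
  then show ?thesis
    by (simp add: UN_binaryset_eq suminf_binaryset_eq hausdorff_pre_empty[OF assms])
qed

text \<open>By Vitali's theorem disjoint small balls fill an open set up to a null set, and for balls
  gauge and volume agree.\<close>

lemma hausdorff_pre_le_lborel:
  fixes T :: "'a::euclidean_space set"
  assumes T: "open T" and \<delta>: "0 < \<delta>"
  shows "hausdorff_pre DIM('a) \<delta> T \<le> emeasure lborel T"
proof -
  define K where "K = {(x::'a, r::real). 0 < r \<and> r \<le> \<delta> / 2 \<and> cball x r \<subseteq> T}"
  have "\<And>i. i \<in> K \<Longrightarrow> 0 < snd i" by (auto simp: K_def)
  moreover have "\<exists>i. i \<in> K \<and> x \<in> cball (fst i) (snd i) \<and> snd i < d" if "x \<in> T" "0 < d" for x d
  proof -
    obtain r where r: "r > 0" "cball x r \<subseteq> T"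
      using T \<open>x \<in> T\<close> unfolding open_contains_cball by blast
    define s where "s = min r (min (\<delta> / 2) (d / 2))"
    have s: "0 < s" "s \<le> r" "s \<le> \<delta> / 2" "s < d" using r(1) \<delta> \<open>0 < d\<close> by (auto simp: s_def)
    have "cball x s \<subseteq> T" using subset_cball[OF s(2)] r(2) by blast
    then have "(x, s) \<in> K" using s by (simp add: K_def)
    then show ?thesis using s by (intro exI[of _ "(x, s)"]) auto
  qed
  ultimately obtain C where C: "countable C" "C \<subseteq> K"
    "pairwise (\<lambda>i j. disjnt (cball (fst i) (snd i)) (cball (fst j) (snd j))) C"
    "negligible (T - (\<Union>i\<in>C. cball (fst i) (snd i)))"
    by (rule Vitali_covering_theorem_cballs)
  let ?U = "\<Union>i\<in>C. cball (fst i) (snd i)"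
  have K: "0 < snd i" "snd i \<le> \<delta> / 2" "cball (fst i) (snd i) \<subseteq> T" if "i \<in> C" for i
    using that C(2) by (cases i; auto simp: K_def subset_eq)+
  have disj: "disjoint_family_on (\<lambda>i. cball (fst i) (snd i)) C"
    using C(3) by (auto simp: disjoint_family_on_def pairwise_def disjnt_def)
  have [measurable]: "?U \<in> sets borel" "T \<in> sets borel"
    using C(1) T by (auto intro: sets.countable_UN')
  have "emeasure lborel (T - ?U) = 0"
    using C(4) by (simp add: negligible_iff_null_sets null_sets_def)
  then have null: "hausdorff_pre DIM('a) \<delta> (T - ?U) = 0"
    by (intro hausdorff_pre_null \<delta>) auto
  have "hausdorff_pre DIM('a) \<delta> T \<le> hausdorff_pre DIM('a) \<delta> (?U \<union> (T - ?U))"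
    by (intro hausdorff_pre_mono) auto
  also have "\<dots> \<le> hausdorff_pre DIM('a) \<delta> ?U"
    using hausdorff_pre_Un[OF \<delta>, of "DIM('a)" ?U "T - ?U"] null by simp
  also have "\<dots> \<le> (\<integral>\<^sup>+i. hausdorff_gauge DIM('a) (cball (fst i) (snd i)) \<partial>count_space C)"
    using K by (intro hausdorff_pre_le_countable_cover C \<delta>) fastforce+
  also have "\<dots> = (\<integral>\<^sup>+i. emeasure lborel (cball (fst i) (snd i)) \<partial>count_space C)"
    using K by (intro nn_integral_cong) (simp add: hausdorff_gauge_cball less_imp_le)
  also have "\<dots> = emeasure lborel ?U"
    using C(1) disj by (simp add: emeasure_UN_countable)
  also have "\<dots> \<le> emeasure lborel T"
    by (intro emeasure_mono UN_least K(3)) auto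
  finally show ?thesis .
qed

text \<open>For the inequality from below, the covering sets may be replaced by their closures without changing their diameters, which makes
  them measurable; the isodiametric inequality then bounds their volumes by their gauges.\<close>

theorem hausdorff_outer_DIM:
  fixes S :: "'a::euclidean_space set"
  assumes [measurable]: "S \<in> sets borel"
  shows "hausdorff_outer DIM('a) S = emeasure lborel S"
proof (rule antisym)
  show "hausdorff_outer DIM('a) S \<le> emeasure lborel S"
    unfolding hausdorff_outer_def
  proof (rule SUP_least, rule ennreal_le_epsilon)
    fix \<delta> e :: real assume \<delta>: "\<delta> \<in> {0<..}" and e: "0 < e"
    obtain U where U: "open U" "S \<subseteq> U" "emeasure lborel (U - S) < ennreal e"
      using outer_regular_lborel[of S e] e by auto
    have [measurable]: "U \<in> sets borel" using U by auto
    have "hausdorff_pre DIM('a) \<delta> S \<le> hausdorff_pre DIM('a) \<delta> U"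
      using U by (intro hausdorff_pre_mono)
    also have "\<dots> \<le> emeasure lborel U" using U \<delta> by (intro hausdorff_pre_le_lborel) auto
    also have "\<dots> = emeasure lborel S + emeasure lborel (U - S)"
      using U(2) by (subst plus_emeasure) (auto simp: Un_absorb1)
    also have "\<dots> \<le> emeasure lborel S + ennreal e" using U by (intro add_left_mono) auto
    finally show "hausdorff_pre DIM('a) \<delta> S \<le> emeasure lborel S + ennreal e" .
  qed
  have "emeasure lborel S \<le> hausdorff_pre DIM('a) 1 S"
    unfolding hausdorff_pre_def
  proof (rule INF_greatest, safe)
    fix U :: "nat \<Rightarrow> 'a set"
    assume cov: "S \<subseteq> (\<Union>k. U k)" and U: "\<forall>k. bounded (U k) \<and> diameter (U k) \<le> 1"
    have "(\<Union>k. U k) \<subseteq> (\<Union>k. closure (U k))"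
      by (intro UN_mono closure_subset order_refl)
    with cov have "emeasure lborel S \<le> emeasure lborel (\<Union>k. closure (U k))"
      by (intro emeasure_mono) auto
    also have "\<dots> \<le> (\<Sum>k. emeasure lborel (closure (U k)))"
      by (intro emeasure_subadditive_countably) auto
    also have "\<dots> \<le> (\<Sum>k. hausdorff_gauge DIM('a) (U k))"
    proof (intro suminf_le)
      fix k
      show "emeasure lborel (closure (U k)) \<le> hausdorff_gauge DIM('a) (U k)"
        using isodiametric[of "closure (U k)"] U
        by (cases "U k = {}") (auto simp: hausdorff_gauge_def diameter_closure)
    qed auto
    finally show "emeasure lborel S \<le> (\<Sum>k. hausdorff_gauge DIM('a) (U k))" .
  qed
  also have "\<dots> \<le> hausdorff_outer DIM('a) S"
    unfolding hausdorff_outer_def by (intro SUP_upper) auto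
  finally show "emeasure lborel S \<le> hausdorff_outer DIM('a) S" .
qed

lemma diameter_image_le:
  assumes "bounded S" "0 \<le> L" "\<And>x y. x \<in> S \<Longrightarrow> y \<in> S \<Longrightarrow> dist (f x) (f y) \<le> L * dist x y"
  shows "bounded (f ` S)" "diameter (f ` S) \<le> L * diameter S"
proof -
  have *: "dist (f x) (f y) \<le> L * diameter S" if "x \<in> S" "y \<in> S" for x y
    using assms(3)[OF that] diameter_bounded_bound[OF assms(1) that] assms(2)
    by (meson mult_left_mono order_trans)
  then show "bounded (f ` S)" unfolding bounded_two_points by blast
  show "diameter (f ` S) \<le> L * diameter S"
    unfolding diameter_def[of "f ` S"] using * by (auto intro!: cSUP_least)
qed

lemma hausdorff_outer_lipschitz_image:
  fixes f :: "'a::metric_space \<Rightarrow> 'b::metric_space"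
  assumes L: "0 < L" and f: "\<And>x y. x \<in> S \<Longrightarrow> y \<in> S \<Longrightarrow> dist (f x) (f y) \<le> L * dist x y"
  shows "hausdorff_outer m (f ` S) \<le> ennreal (L ^ m) * hausdorff_outer m S"
  unfolding hausdorff_outer_def[of m "f ` S"]
proof (rule SUP_least)
  fix \<delta> :: real assume "\<delta> \<in> {0<..}"
  then have \<delta>: "0 < \<delta>" by simp
  have "ennreal (1 / L ^ m) * hausdorff_pre m \<delta> (f ` S) \<le> hausdorff_pre m (\<delta> / L) S"
    unfolding hausdorff_pre_def[of m "\<delta> / L"]
  proof (rule INF_greatest, safe)
    fix U :: "nat \<Rightarrow> 'a set"
    assume cov: "S \<subseteq> (\<Union>k. U k)" and U: "\<forall>k. bounded (U k) \<and> diameter (U k) \<le> \<delta> / L"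
    define V where "V k = f ` (U k \<inter> S)" for k
    have b: "bounded (U k \<inter> S)" for k using U by (blast intro: bounded_subset)
    have V: "bounded (V k)" "diameter (V k) \<le> L * diameter (U k)" for k
    proof -
      have "diameter (U k \<inter> S) \<le> diameter (U k)"
        using U by (intro diameter_subset) auto
      then show "bounded (V k)" "diameter (V k) \<le> L * diameter (U k)"
        using diameter_image_le[OF b[of k], of L f] f L mult_left_mono[of _ _ L] unfolding V_def
        by (auto intro: order_trans)
    qed
    have "hausdorff_pre m \<delta> (f ` S) \<le> (\<Sum>k. hausdorff_gauge m (V k))"
      unfolding hausdorff_pre_def
    proof (rule INF_lower, safe)
      fix x assume "x \<in> S"
      with cov obtain k where "x \<in> U k" by blast
      with \<open>x \<in> S\<close> have "f x \<in> V k" by (simp add: V_def)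
      then show "f x \<in> (\<Union>k. V k)" by blast
    next
      fix k
      show "bounded (V k)" by fact
      have "L * diameter (U k) \<le> \<delta>" using U L by (simp add: field_simps)
      then show "diameter (V k) \<le> \<delta>" using V(2)[of k] by linarith
    qed
    also have "\<dots> \<le> (\<Sum>k. ennreal (L ^ m) * hausdorff_gauge m (U k))"
    proof (intro suminf_le)
      fix k
      show "hausdorff_gauge m (V k) \<le> ennreal (L ^ m) * hausdorff_gauge m (U k)"
      proof (cases "V k = {}")
        case False
        then have ne: "U k \<noteq> {}" by (auto simp: V_def)
        have "(diameter (V k) / 2) ^ m \<le> (L * (diameter (U k) / 2)) ^ m"
          using V[of k] diameter_ge_0[OF V(1)] by (intro power_mono) auto
        then have "unit_ball_vol (real m) * (diameter (V k) / 2) ^ m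
            \<le> L ^ m * (unit_ball_vol (real m) * (diameter (U k) / 2) ^ m)"
          unfolding power_mult_distrib mult.left_commute[of "L ^ m"]
          by (intro mult_left_mono) auto
        then show ?thesis using False ne L
          by (simp add: hausdorff_gauge_def ennreal_leI flip: ennreal_mult')
      qed simp
    qed auto
    finally have "hausdorff_pre m \<delta> (f ` S) \<le> ennreal (L ^ m) * (\<Sum>k. hausdorff_gauge m (U k))"
      by simp
    then have "ennreal (1 / L ^ m) * hausdorff_pre m \<delta> (f ` S)
        \<le> ennreal (1 / L ^ m) * (ennreal (L ^ m) * (\<Sum>k. hausdorff_gauge m (U k)))"
      by (rule mult_left_mono) simp
    also have "\<dots> = (\<Sum>k. hausdorff_gauge m (U k))"
      using L by (simp add: mult.assoc[symmetric] flip: ennreal_mult')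
    finally show "ennreal (1 / L ^ m) * hausdorff_pre m \<delta> (f ` S) \<le> (\<Sum>k. hausdorff_gauge m (U k))" .
  qed
  also have "\<dots> \<le> hausdorff_outer m S"
    unfolding hausdorff_outer_def using L \<delta> by (intro SUP_upper) auto
  finally have "ennreal (L ^ m) * (ennreal (1 / L ^ m) * hausdorff_pre m \<delta> (f ` S))
      \<le> ennreal (L ^ m) * hausdorff_outer m S"
    by (rule mult_left_mono) simp
  then show "hausdorff_pre m \<delta> (f ` S) \<le> ennreal (L ^ m) * hausdorff_outer m S"
    using L by (simp add: mult.assoc[symmetric] flip: ennreal_mult')
qed

section \<open>Splitting off one coordinate\<close>

text \<open>An index type with one element less than \<open>'n\<close>, so that the hyperplane orthogonal to a
  coordinate axis of \<open>\<real>\<^sup>n\<close> is itself a Euclidean space to which the results on full-dimensional Hausdorff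
  measure apply. The maximum keeps the type inhabited if \<open>'n\<close> has one element.\<close>

typedef 'n minus_one = "{..<max 1 (CARD('n::finite) - 1)} :: nat set"
  by (rule exI[of _ 0]) simp

instance minus_one :: (finite) finite
proof
  show "finite (UNIV :: 'a minus_one set)"
    unfolding type_definition.univ[OF type_definition_minus_one] by simp
qed

lemma card_minus_one:
  assumes "CARD('n::finite) \<ge> 2"
  shows "CARD('n minus_one) = CARD('n) - 1"
  using assms type_definition.card[OF type_definition_minus_one[where 'n = 'n]] by simp

definition coord :: "'n::finite \<Rightarrow> 'n minus_one \<Rightarrow> 'n" where
  "coord i = (SOME f. bij_betw f UNIV (UNIV - {i}))"

definition drop_coord :: "'n::finite \<Rightarrow> real ^ 'n \<Rightarrow> real ^ 'n minus_one" where
  "drop_coord i x = (\<chi> k. x $ coord i k)"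

definition insert_coord :: "'n::finite \<Rightarrow> real ^ 'n minus_one \<Rightarrow> real \<Rightarrow> real ^ 'n" where
  "insert_coord i v t = (\<chi> j. if j = i then t else v $ inv_into UNIV (coord i) j)"

context
  fixes i :: "'n::finite"
  assumes card_ge_2: "CARD('n) \<ge> 2"
begin

lemma bij_coord: "bij_betw (coord i) UNIV (UNIV - {i})"
proof -
  have "CARD('n minus_one) = card (UNIV - {i})"
    using card_minus_one[OF card_ge_2] by (simp add: card_Diff_singleton)
  then have "\<exists>f. bij_betw f (UNIV :: 'n minus_one set) (UNIV - {i})"
    by (intro finite_same_card_bij) auto
  then show ?thesis unfolding coord_def by (rule someI_ex)
qed

lemma coord_neq [simp]: "coord i k \<noteq> i"
  using bij_coord by (auto simp: bij_betw_def)

lemma inv_coord [simp]: "inv_into UNIV (coord i) (coord i k) = k"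
  using bij_coord by (simp add: bij_betw_def inv_into_f_f)

lemma coord_cases:
  obtains "j = i" | k where "j = coord i k"
  using bij_coord by (cases "j = i") (auto simp: bij_betw_def)

lemma sum_coord: "(\<Sum>j\<in>UNIV. f j) = f i + (\<Sum>k\<in>UNIV. f (coord i k))" for f :: "'n \<Rightarrow> 'b::comm_monoid_add"
  by (subst sum.remove[of _ i]) (auto simp: sum.reindex_bij_betw[OF bij_coord])

lemma prod_coord: "(\<Prod>j\<in>UNIV. f j) = f i * (\<Prod>k\<in>UNIV. f (coord i k))" for f :: "'n \<Rightarrow> 'b::comm_monoid_mult"
  by (subst prod.remove[of _ i]) (auto simp: prod.reindex_bij_betw[OF bij_coord])

lemma all_coord: "(\<forall>j. P j) \<longleftrightarrow> P i \<and> (\<forall>k. P (coord i k))"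
  by (metis coord_cases)

lemma insert_coord_nth [simp]: "insert_coord i v t $ i = t" "insert_coord i v t $ coord i k = v $ k"
  by (simp_all add: insert_coord_def)

lemma drop_coord_nth [simp]: "drop_coord i x $ k = x $ coord i k"
  by (simp add: drop_coord_def)

lemma drop_insert_coord [simp]: "drop_coord i (insert_coord i v t) = v"
  by (simp add: vec_eq_iff)

lemma insert_drop_coord: "x = insert_coord i (drop_coord i x) (x $ i)"
  unfolding vec_eq_iff by (metis coord_cases drop_coord_nth insert_coord_nth)

lemma dist_insert_coord: "(dist x y)\<^sup>2 = (dist (drop_coord i x) (drop_coord i y))\<^sup>2 + (x $ i - y $ i)\<^sup>2"
  unfolding dist_norm power2_norm_eq_inner inner_vec_def
  by (subst sum_coord) (simp add: power2_eq_square)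

lemma dist_drop_coord_le: "dist (drop_coord i x) (drop_coord i y) \<le> dist x y"
  by (rule power2_le_imp_le) (simp_all add: dist_insert_coord)

lemma dist_insert_coord_le:
  "dist (insert_coord i v s) (insert_coord i w t) \<le> dist v w + \<bar>s - t\<bar>"
proof (rule power2_le_imp_le)
  show "(dist (insert_coord i v s) (insert_coord i w t))\<^sup>2 \<le> (dist v w + \<bar>s - t\<bar>)\<^sup>2"
    by (simp add: dist_insert_coord power2_sum)
qed simp

lemma continuous_drop_coord: "continuous_on S (drop_coord i)"
  unfolding drop_coord_def by (intro continuous_intros)

lemma continuous_insert_coord: "continuous_on S (\<lambda>p. insert_coord i (fst p) (snd p))"
proof -
  have "continuous_on S (\<lambda>p. (if j = i then snd p else fst p $ inv_into UNIV (coord i) j) :: real)" for j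
    by (cases "j = i") (auto intro!: continuous_intros)
  then show ?thesis unfolding insert_coord_def by (intro continuous_on_vec_lambda)
qed

lemma borel_measurable_drop_coord [measurable]: "drop_coord i \<in> borel_measurable borel"
  by (intro borel_measurable_continuous_onI continuous_drop_coord)

lemma borel_measurable_insert_coord [measurable (raw)]:
  assumes [measurable]: "f \<in> borel_measurable M" "g \<in> borel_measurable M"
  shows "(\<lambda>x. insert_coord i (f x) (g x)) \<in> borel_measurable M"
proof -
  have "(\<lambda>p. insert_coord i (fst p) (snd p)) \<in> borel_measurable borel"
    by (intro borel_measurable_continuous_onI continuous_insert_coord)
  then have "(\<lambda>x. insert_coord i (fst (f x, g x)) (snd (f x, g x))) \<in> borel_measurable M"
    by (rule measurable_compose[rotated]) (simp add: borel_prod[symmetric])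
  then show ?thesis by simp
qed

text \<open>Both measures agree on boxes, whose preimages are products of a box and an interval.\<close>

lemma lborel_insert_coord:
  "lborel = distr (lborel \<Otimes>\<^sub>M lborel) borel (\<lambda>p. insert_coord i (fst p) (snd p))" (is "_ = ?M")
proof (rule lborel_eqI)
  fix l u :: "real ^ 'n" assume lu: "\<And>b. b \<in> Basis \<Longrightarrow> l \<bullet> b \<le> u \<bullet> b"
  then have le: "l $ j \<le> u $ j" for j
    using axis_in_Basis_iff[of j "1::real"] by (metis Basis_real_def cart_eq_inner_axis singletonI)
  have vec: "(\<Prod>b\<in>Basis. w \<bullet> b) = (\<Prod>j\<in>UNIV. w $ j)" for w :: "real ^ 'm::finite"
  proof -
    have "bij_betw (\<lambda>j::'m. axis j (1::real)) UNIV Basis"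
      by (auto simp: bij_betw_def inj_on_def axis_eq_axis Basis_vec_def)
    from prod.reindex_bij_betw[OF this, of "(\<bullet>) w"] show ?thesis
      by (simp add: cart_eq_inner_axis)
  qed
  have leb: "drop_coord i l \<bullet> b \<le> drop_coord i u \<bullet> b" if "b \<in> Basis" for b
    using that le by (auto simp: Basis_vec_def simp flip: cart_eq_inner_axis)
  have "(\<lambda>p. insert_coord i (fst p) (snd p)) -` box l u
      = box (drop_coord i l) (drop_coord i u) \<times> {l $ i <..< u $ i}"
    by (auto simp: mem_box_cart all_coord)
  then have "emeasure ?M (box l u)
      = emeasure (lborel \<Otimes>\<^sub>M lborel) (box (drop_coord i l) (drop_coord i u) \<times> {l $ i <..< u $ i})"
    by (subst emeasure_distr) (auto simp: space_pair_measure)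
  also have "\<dots> = emeasure lborel (box (drop_coord i l) (drop_coord i u)) * emeasure lborel {l $ i <..< u $ i}"
    by (intro lborel.emeasure_pair_measure_Times) auto
  also have "\<dots> = (\<Prod>b\<in>Basis. (u - l) \<bullet> b)"
    using le leb by (simp add: emeasure_lborel_box vec prod_coord ennreal_mult[symmetric] prod_nonneg
      mult.commute)
  finally show "emeasure ?M (box l u) = (\<Prod>b\<in>Basis. (u - l) \<bullet> b)" .
qed simp

lemma nn_integral_insert_coord:
  assumes [measurable]: "f \<in> borel_measurable borel"
  shows "(\<integral>\<^sup>+x. f x \<partial>lborel) = (\<integral>\<^sup>+v. \<integral>\<^sup>+t. f (insert_coord i v t) \<partial>lborel \<partial>lborel)"
proof -
  have "(\<integral>\<^sup>+x. f x \<partial>lborel) = (\<integral>\<^sup>+p. f (insert_coord i (fst p) (snd p)) \<partial>(lborel \<Otimes>\<^sub>M lborel))"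
    by (subst lborel_insert_coord, subst nn_integral_distr) auto
  also have "\<dots> = (\<integral>\<^sup>+v. \<integral>\<^sup>+t. f (insert_coord i v t) \<partial>lborel \<partial>lborel)"
    by (subst lborel.nn_integral_fst[symmetric]) auto
  finally show ?thesis .
qed

lemma monomial_weight_coord:
  "monomial_weight A x = (if A $ i = 0 then 1 else \<bar>x $ i\<bar> powr (A $ i)) *
     monomial_weight (drop_coord i A) (drop_coord i x)"
  unfolding monomial_weight_def drop_coord_nth by (rule prod_coord)

end

lemma AE_nth_neq_0: "AE x :: real ^ 'n::finite in lborel. x $ k \<noteq> 0"
proof -
  have "negligible {x :: real ^ 'n. x $ k = 0}" by (rule negligible_standard_hyperplane_cart)
  then have "{x :: real ^ 'n. x $ k = 0} \<in> null_sets lborel"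
    by (simp add: negligible_iff_null_sets null_sets_def)
  from AE_not_in[OF this] show ?thesis by simp
qed

lemma monomial_weight_nonneg: "0 \<le> monomial_weight A x"
  unfolding monomial_weight_def by (intro prod_nonneg) auto

lemma borel_measurable_monomial_weight [measurable]:
  "monomial_weight A \<in> borel_measurable borel"
  unfolding monomial_weight_def by measurable

section \<open>The weighted inequality on a half line\<close>

text \<open>The weight along a coordinate line, normalised such that \<open>{0..c}\<close> has mass \<open>c powr a\<close>.\<close>

definition power_measure :: "real \<Rightarrow> real measure" where
  "power_measure a = density lborel (\<lambda>x. ennreal (a * x powr (a - 1)))"

lemma sets_power_measure [simp, measurable_cong]: "sets (power_measure a) = sets borel"
  by (simp add: power_measure_def)

lemma emeasure_power_measure_Icc:
  assumes "0 < a" "0 \<le> c"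
  shows "emeasure (power_measure a) {0..c} = ennreal (c powr a)"
proof -
  have "((\<lambda>x. x powr (a - 1)) has_integral (c powr a / a)) {0..c}"
    using has_integral_powr_from_0[of "a - 1" c] assms by simp
  then have "((\<lambda>x. a * x powr (a - 1)) has_integral (a * (c powr a / a))) {0..c}"
    by (rule has_integral_mult_right)
  then have "((\<lambda>x. a * x powr (a - 1)) has_integral (c powr a)) {0..c}"
    using assms by simp
  then have "(\<integral>\<^sup>+x. ennreal (a * x powr (a - 1)) * indicator {0..c} x \<partial>lborel) = ennreal (c powr a)"
    using assms by (intro nn_integral_has_integral_lebesgue') auto
  then show ?thesis by (simp add: power_measure_def emeasure_density)
qed

lemma emeasure_power_measure_Ioc:
  assumes "0 < a" "0 \<le> s" "s \<le> u"
  shows "emeasure (power_measure a) {s<..u} = ennreal (u powr a - s powr a)"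
proof -
  have "{s<..u} = {0..u} - {0..s}" using assms by auto
  also have "emeasure (power_measure a) \<dots>
      = emeasure (power_measure a) {0..u} - emeasure (power_measure a) {0..s}"
    using assms by (intro emeasure_Diff) (auto simp: emeasure_power_measure_Icc)
  finally show ?thesis using assms by (simp add: emeasure_power_measure_Icc ennreal_minus)
qed

text \<open>A discrete form of the estimate of each component by its right endpoint. Call a cell
  \<open>(t k, t (k + 1)]\<close> hit if it meets the boundary. A cell that is not hit lies inside or outside of \<open>D\<close>.
  The masses of a run of consecutive cells inside \<open>D\<close> telescope, and are absorbed by the next hit
  cell. The last summand accounts for a run that is still going on at \<open>t n\<close>.\<close>

lemma emeasure_power_measure_partial:
  fixes D F :: "real set" and t :: "nat \<Rightarrow> real"
  assumes D: "open D" and F: "frontier D \<subseteq> F" and a: "0 < a"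
    and t: "\<And>n. 0 \<le> t n" "\<And>n. t n < t (Suc n)"
  shows "emeasure (power_measure a) (D \<inter> {t 0<..t n})
    \<le> (\<Sum>k<n. ennreal (t (Suc k) powr a) * of_bool (F \<inter> {t k<..t (Suc k)} \<noteq> {}))
      + ennreal (t n powr a) * of_bool (t n \<in> D)"
proof (induction n)
  case 0
  then show ?case by simp
next
  case (Suc n)
  let ?m = "emeasure (power_measure a)" and ?G = "\<lambda>n. ennreal (t n powr a)"
  let ?S = "\<lambda>n. \<Sum>k<n. ?G (Suc k) * of_bool (F \<inter> {t k<..t (Suc k)} \<noteq> {})"
  let ?J = "{t n<..t (Suc n)}"
  have [measurable]: "D \<in> sets borel" using D by simp
  have le: "t n \<le> t (Suc n)" for n using t(2) by (rule less_imp_le)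
  then have "t 0 \<le> t n" by (rule lift_Suc_mono_le) simp
  then have "{t 0<..t (Suc n)} = {t 0<..t n} \<union> ?J" using le[of n] by auto
  then have "?m (D \<inter> {t 0<..t (Suc n)}) = ?m ((D \<inter> {t 0<..t n}) \<union> (D \<inter> ?J))"
    by (simp add: Int_Un_distrib)
  also have "\<dots> \<le> ?m (D \<inter> {t 0<..t n}) + ?m (D \<inter> ?J)"
    by (intro emeasure_subadditive) auto
  also have "\<dots> \<le> ?S (Suc n) + ?G (Suc n) * of_bool (t (Suc n) \<in> D)"
  proof (cases "D \<inter> ?J = {}")
    case True
    \<comment> \<open>Either no run is going on at \<open>t n\<close>, or it ends in this cell.\<close>
    have "?m (D \<inter> {t 0<..t n}) \<le> ?S (Suc n)"
    proof (cases "F \<inter> ?J = {}")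
      case unhit: True
      have "t n \<notin> D"
      proof
        assume *: "t n \<in> D"
        then obtain e where e: "e > 0" "ball (t n) e \<subseteq> D" using D openE by blast
        have "min (t n + e / 2) (t (Suc n)) \<in> D \<inter> ?J"
          using t(2)[of n] e by (auto simp: dist_real_def subset_eq min_def)
        then show False using True by blast
      qed
      then show ?thesis using Suc unhit by simp
    next
      case False
      have "?m (D \<inter> {t 0<..t n}) \<le> ?S n + ?G n" using Suc by (rule order_trans) (auto simp: of_bool_def)
      also have "?G n \<le> ?G (Suc n)" using t(1) le a by (intro ennreal_leI powr_mono2) auto
      finally show ?thesis using False by (simp add: add_left_mono)
    qed
    with True show ?thesis by (auto intro: order_trans)
  next
    case False
    have "?m (D \<inter> {t 0<..t n}) + ?m (D \<inter> ?J) \<le> (?S n + ?G n) + ennreal (t (Suc n) powr a - t n powr a)"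
    proof (rule add_mono)
      show "?m (D \<inter> {t 0<..t n}) \<le> ?S n + ?G n" using Suc by (rule order_trans) (auto simp: of_bool_def)
      have "?m (D \<inter> ?J) \<le> ?m ?J" by (intro emeasure_mono) auto
      also have "\<dots> = ennreal (t (Suc n) powr a - t n powr a)"
        using a t(1) le by (intro emeasure_power_measure_Ioc) auto
      finally show "?m (D \<inter> ?J) \<le> ennreal (t (Suc n) powr a - t n powr a)" .
    qed
    also have "\<dots> = ?S n + ?G (Suc n)"
      using t(1) le[of n] a powr_mono2[of a "t n" "t (Suc n)"]
      by (simp add: add.assoc ennreal_plus[symmetric] del: ennreal_plus)
    also have "\<dots> \<le> ?S (Suc n) + ?G (Suc n) * of_bool (t (Suc n) \<in> D)"
    proof (cases "F \<inter> ?J = {}")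
      case True
      have "?J \<subseteq> D"
      proof (rule ccontr)
        assume "\<not> ?J \<subseteq> D"
        then have "?J \<inter> frontier D \<noteq> {}"
          using False by (intro connected_Int_frontier) auto
        then show False using True F by blast
      qed
      moreover have "t (Suc n) \<in> ?J" using False by auto
      ultimately have "t (Suc n) \<in> D" by blast
      then show ?thesis by simp
    next
      case hit: False
      then show ?thesis by simp
    qed
    finally show ?thesis .
  qed
  finally show ?case .
qed

text \<open>As the mass is finite, the last run of cells inside \<open>D\<close> ends, so the correction term of
  \<open>emeasure_power_measure_partial\<close> vanishes for arbitrarily large \<open>n\<close>.\<close>

lemma emeasure_power_measure_open_le:
  fixes D F :: "real set" and t :: "nat \<Rightarrow> real"
  assumes D: "open D" and F: "frontier D \<subseteq> F" and a: "0 < a"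
    and t: "0 < t 0" "\<And>n. t n < t (Suc n)" "filterlim t at_top sequentially"
    and fin: "emeasure (power_measure a) (D \<inter> {t 0<..}) \<noteq> \<infinity>"
  shows "emeasure (power_measure a) (D \<inter> {t 0<..})
    \<le> (\<Sum>k. ennreal (t (Suc k) powr a) * of_bool (F \<inter> {t k<..t (Suc k)} \<noteq> {}))" (is "_ \<le> ?S")
proof (cases "?S = \<infinity>")
  case True
  then show ?thesis by simp
next
  case False
  let ?m = "emeasure (power_measure a)"
  have [measurable]: "D \<in> sets borel" using D by simp
  have mono: "t k \<le> t n" if "k \<le> n" for k n
    by (rule lift_Suc_mono_le[of t, OF less_imp_le[OF t(2)] that])
  have pos: "0 < t n" for n using t(1) mono[of 0 n] by simp
  have "(\<lambda>n. ?m (D \<inter> {t 0<..t n})) \<longlonglongrightarrow> ?m (\<Union>n. D \<inter> {t 0<..t n})"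
    using mono by (intro Lim_emeasure_incseq) (force simp: incseq_def)+
  moreover have "(\<Union>n. D \<inter> {t 0<..t n}) = D \<inter> {t 0<..}"
  proof -
    have "\<exists>n. x \<le> t n" for x
      using t(3) by (auto simp: filterlim_at_top eventually_sequentially)
    then show ?thesis by auto
  qed
  ultimately have lim: "(\<lambda>n. ?m (D \<inter> {t 0<..t n})) \<longlonglongrightarrow> ?m (D \<inter> {t 0<..})" by simp
  have part: "?m (D \<inter> {t 0<..t n}) \<le> ?S" if "t n \<notin> D" for n
  proof -
    have "?m (D \<inter> {t 0<..t n})
        \<le> (\<Sum>k<n. ennreal (t (Suc k) powr a) * of_bool (F \<inter> {t k<..t (Suc k)} \<noteq> {}))"
      using emeasure_power_measure_partial[OF D F a, of t n] that t pos by (simp add: less_imp_le)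
    also have "\<dots> \<le> ?S" by (intro sum_le_suminf) auto
    finally show ?thesis .
  qed
  have outside: "\<exists>n\<ge>N. t n \<notin> D" for N
  proof (rule ccontr)
    assume "\<not> ?thesis"
    then have inD: "t n \<in> D" if "n \<ge> N" for n using that by blast
    \<comment> \<open>Finiteness of the sum means that only finitely many cells are hit. If moreover all \<open>t n\<close>
      from some index on lie in \<open>D\<close>, then so does a half line, which has infinite mass.\<close>
    let ?g = "\<lambda>k. t (Suc k) powr a * of_bool (F \<inter> {t k<..t (Suc k)} \<noteq> {})"
    have "?S = (\<Sum>k. ennreal (?g k))" by (intro suminf_cong) (auto simp: of_bool_def)
    then have "summable ?g"
      using False by (intro summable_suminf_not_top) auto
    then have "?g \<longlonglongrightarrow> 0" by (rule summable_LIMSEQ_zero)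
    then have "\<forall>\<^sub>F k in sequentially. ?g k < t 0 powr a"
      using t(1) by (intro order_tendstoD) auto
    then obtain N' where N': "?g k < t 0 powr a" if "k \<ge> N'" for k
      by (auto simp: eventually_sequentially)
    have unhit: "F \<inter> {t k<..t (Suc k)} = {}" if "k \<ge> N'" for k
    proof (rule ccontr)
      assume "\<not> ?thesis"
      then have "t (Suc k) powr a < t 0 powr a" using N'[OF that] by simp
      moreover have "t 0 powr a \<le> t (Suc k) powr a"
        using a t(1) mono[of 0 "Suc k"] by (intro powr_mono2) auto
      ultimately show False by simp
    qed
    define M where "M = max N N'"
    have sub: "{t k<..t (Suc k)} \<subseteq> D" if "k \<ge> M" for k
    proof (rule ccontr)
      assume *: "\<not> ?thesis"
      have "t (Suc k) \<in> {t k<..t (Suc k)} \<inter> D" using inD[of "Suc k"] that t(2)[of k] by (auto simp: M_def)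
      then have "{t k<..t (Suc k)} \<inter> frontier D \<noteq> {}"
        using * by (intro connected_Int_frontier connected_Ioc) blast+
      then show False using unhit[of k] that F by (auto simp: M_def)
    qed
    have big: "{t M<..t n} \<subseteq> D" if "n \<ge> M" for n
      using that
    proof (induction n rule: dec_induct)
      case (step n)
      then show ?case using sub[of n] by (auto simp: subset_eq)
    qed simp
    obtain r where r: "?m (D \<inter> {t 0<..}) = ennreal r" "0 \<le> r"
      using fin by (cases "?m (D \<inter> {t 0<..})") auto
    have le: "t n powr a \<le> r + t M powr a" if "n \<ge> M" for n
    proof -
      have "ennreal (t n powr a - t M powr a) = ?m {t M<..t n}"
        using a pos mono[OF that] by (intro emeasure_power_measure_Ioc[symmetric]) (auto intro: less_imp_le)
      also have "\<dots> \<le> ?m (D \<inter> {t 0<..})"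
        using big[OF that] mono[of 0 M] by (intro emeasure_mono) auto
      finally show ?thesis using r by (simp add: ennreal_le_iff)
    qed
    define c where "c = r + t M powr a + 1"
    have c: "0 < c" using r(2) by (simp add: c_def add_nonneg_pos)
    have "\<forall>\<^sub>F n in sequentially. c powr (1 / a) \<le> t n \<and> M \<le> n"
      using t(3) by (intro eventually_conj eventually_ge_at_top) (simp add: filterlim_at_top)
    then obtain n where n: "c powr (1 / a) \<le> t n" "M \<le> n"
      using eventually_happens'[OF sequentially_bot] by blast
    have "(c powr (1 / a)) powr a \<le> t n powr a"
      using n(1) a by (intro powr_mono2) auto
    then have "c \<le> t n powr a" using a c by (simp add: powr_powr)
    then show False using le[OF n(2)] by (simp add: c_def)
  qed
  have "?m (D \<inter> {t 0<..t n}) \<le> ?S" for n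
  proof -
    obtain k where k: "k \<ge> n" "t k \<notin> D" using outside by blast
    have "?m (D \<inter> {t 0<..t n}) \<le> ?m (D \<inter> {t 0<..t k})"
      using mono[OF k(1)] by (intro emeasure_mono) auto
    also have "\<dots> \<le> ?S" using k(2) by (rule part)
    finally show ?thesis .
  qed
  then show ?thesis using lim by (intro LIMSEQ_le_const2) auto
qed

section \<open>The lower bound for open sets\<close>

context
  fixes i :: "'n::finite"
  assumes card_ge_2: "CARD('n) \<ge> 2"
begin

text \<open>The projection that forgets the coordinate \<open>i\<close> has Lipschitz constant \<open>1\<close>, so the image
  of the Hausdorff measure on \<open>Z\<close> under it dominates Lebesgue measure on \<open>E\<close>.\<close>

lemma nn_integral_drop_coord_le:
  fixes Z :: "(real ^ 'n) set"
  assumes [measurable]: "Z \<in> sets borel" "E \<in> sets borel" "f \<in> borel_measurable borel"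
    and E: "E \<subseteq> drop_coord i ` Z"
  shows "(\<integral>\<^sup>+v. f v * indicator E v \<partial>lborel)
    \<le> (\<integral>\<^sup>+x. f (drop_coord i x) * indicator Z x \<partial>hausdorff (CARD('n) - 1))"
proof -
  note [measurable] = borel_measurable_drop_coord[OF card_ge_2]
  let ?H = "hausdorff (CARD('n) - 1) :: (real ^ 'n) measure"
  let ?M = "density lborel (indicator E) :: (real ^ 'n minus_one) measure"
  let ?N = "distr (density ?H (indicator Z)) borel (drop_coord i)"
  have dim: "CARD('n) - 1 = DIM(real ^ 'n minus_one)"
    using card_minus_one[OF card_ge_2] by simp
  have "?M \<le> ?N"
  proof (subst le_measure)
    show "sets ?M = sets ?N" by simp
    show "\<forall>S\<in>sets ?M. emeasure ?M S \<le> emeasure ?N S"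
    proof
      fix S :: "(real ^ 'n minus_one) set" assume "S \<in> sets ?M"
      then have [measurable]: "S \<in> sets borel" by simp
      have "emeasure ?M S = emeasure lborel (E \<inter> S)"
        by (simp add: emeasure_density indicator_inter_arith[symmetric])
      also have "\<dots> = hausdorff_outer (CARD('n) - 1) (E \<inter> S)"
        unfolding dim by (rule hausdorff_outer_DIM[symmetric]) simp
      also have "\<dots> \<le> hausdorff_outer (CARD('n) - 1) (drop_coord i ` (Z \<inter> drop_coord i -` S))"
        using E by (intro hausdorff_outer_mono) auto
      also have "\<dots> \<le> ennreal (1 ^ (CARD('n) - 1)) * hausdorff_outer (CARD('n) - 1) (Z \<inter> drop_coord i -` S)"
        by (rule hausdorff_outer_lipschitz_image) (simp_all add: dist_drop_coord_le[OF card_ge_2])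
      also have "\<dots> = emeasure ?H (Z \<inter> drop_coord i -` S)"
        by (simp add: emeasure_hausdorff measurable_sets_borel[OF borel_measurable_drop_coord[OF card_ge_2]])
      also have "\<dots> = emeasure ?N S"
        by (simp add: emeasure_distr emeasure_density indicator_inter_arith[symmetric]
          measurable_sets_borel[OF borel_measurable_drop_coord[OF card_ge_2]])
      finally show "emeasure ?M S \<le> emeasure ?N S" .
    qed
  qed
  then have "(\<integral>\<^sup>+v. f v \<partial>?M) \<le> (\<integral>\<^sup>+v. f v \<partial>?N)"
    by (intro nn_integral_mono_measure) simp_all
  then show ?thesis by (simp add: nn_integral_density nn_integral_distr mult.commute)
qed

text \<open>A slab that is open on one side is a countable union of closed ones, and projections of compact
  sets are compact.\<close>

lemma borel_drop_coord_strip: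
  assumes "closed C"
  shows "drop_coord i ` (C \<inter> {x. l < s * x $ i \<and> s * x $ i \<le> u}) \<in> sets borel"
proof -
  define K where "K j = C \<inter> {x. l + 1 / real (Suc j) \<le> s * x $ i \<and> s * x $ i \<le> u} \<inter> cball 0 (real j)" for j
  have "compact (drop_coord i ` K j)" for j
  proof (rule compact_continuous_image[OF continuous_drop_coord[OF card_ge_2]])
    have "closed ({x. l + 1 / real (Suc j) \<le> s * x $ i} \<inter> {x. s * x $ i \<le> u})"
      by (intro closed_Int closed_Collect_le continuous_intros)
    then have "closed (C \<inter> ({x. l + 1 / real (Suc j) \<le> s * x $ i} \<inter> {x. s * x $ i \<le> u}))"
      using assms by blast
    then show "compact (K j)"
      unfolding K_def Collect_conj_eq by (rule closed_Int_compact) simp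
  qed
  then have "(\<Union>j. drop_coord i ` K j) \<in> sets borel"
    by (intro sets.countable_UN) (auto intro: borel_compact)
  also have "(\<Union>j. drop_coord i ` K j) = drop_coord i ` (C \<inter> {x. l < s * x $ i \<and> s * x $ i \<le> u})"
  proof -
    have ex: "\<exists>j. l + 1 / real (Suc j) \<le> s * x $ i \<and> x \<in> cball 0 (real j)" if lt: "l < s * x $ i" for x
    proof -
      obtain j1 where j1: "inverse (real (Suc j1)) < s * x $ i - l"
        using reals_Archimedean[of "s * x $ i - l"] lt unfolding diff_gt_0_iff_gt by blast
      obtain j2 where j2: "norm x \<le> real j2" using real_arch_simple by blast
      have "1 / real (Suc (max j1 j2)) \<le> inverse (real (Suc j1))"
        by (simp add: field_simps)
      then show ?thesis using j1 j2 by (intro exI[of _ "max j1 j2"]) (auto simp: le_max_iff_disj)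
    qed
    have less: "l < y" if "l + 1 / real (Suc j) \<le> y" for j y
      by (rule less_le_trans[OF _ that]) simp
    have "(\<Union>j. K j) = C \<inter> {x. l < s * x $ i \<and> s * x $ i \<le> u}"
    proof (intro set_eqI iffI)
      fix x assume "x \<in> (\<Union>j. K j)"
      then obtain j where "x \<in> K j" by blast
      then show "x \<in> C \<inter> {x. l < s * x $ i \<and> s * x $ i \<le> u}"
        using less[of j "s * x $ i"] by (simp add: K_def)
    next
      fix x assume x: "x \<in> C \<inter> {x. l < s * x $ i \<and> s * x $ i \<le> u}"
      then obtain j where "l + 1 / real (Suc j) \<le> s * x $ i" "x \<in> cball 0 (real j)"
        using ex[of x] by auto
      with x have "x \<in> K j" by (simp add: K_def)
      then show "x \<in> (\<Union>j. K j)" by blast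
    qed
    then show ?thesis by (simp only: image_UN[symmetric])
  qed
  finally show ?thesis .
qed

lemma open_slice: "open \<Omega> \<Longrightarrow> open {r. insert_coord i v (s * r) \<in> \<Omega>}"
  and frontier_slice_subset:
    "open \<Omega> \<Longrightarrow> frontier {r. insert_coord i v (s * r) \<in> \<Omega>} \<subseteq> {r. insert_coord i v (s * r) \<in> frontier \<Omega>}"
proof -
  assume \<Omega>: "open \<Omega>"
  have "continuous_on UNIV (\<lambda>r. insert_coord i (fst (v, s * r)) (snd (v, s * r)))"
    by (rule continuous_on_compose2[OF continuous_insert_coord[OF card_ge_2, of UNIV]])
       (auto intro!: continuous_intros)
  then have c: "continuous_on UNIV (\<lambda>r. insert_coord i v (s * r))" by simp
  show o: "open {r. insert_coord i v (s * r) \<in> \<Omega>}"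
    using open_vimage[OF \<Omega> c] by (simp add: vimage_def)
  have "closed {r. insert_coord i v (s * r) \<in> closure \<Omega>}"
    using closed_vimage[OF closed_closure c, of \<Omega>] by (simp add: vimage_def)
  then have "closure {r. insert_coord i v (s * r) \<in> \<Omega>} \<subseteq> {r. insert_coord i v (s * r) \<in> closure \<Omega>}"
    using closure_subset by (intro closure_minimal) auto
  then show "frontier {r. insert_coord i v (s * r) \<in> \<Omega>} \<subseteq> {r. insert_coord i v (s * r) \<in> frontier \<Omega>}"
    using \<Omega> o by (auto simp: frontier_def interior_open)
qed

end

locale raised_exponent =
  fixes A B :: "real ^ 'n::finite" and i :: 'n
  assumes card_ge_2: "CARD('n) \<ge> 2"
    and B_nonneg: "\<And>j. 0 \<le> B $ j"
    and A_eq_B: "\<And>j. j \<noteq> i \<Longrightarrow> A $ j = B $ j"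
    and A_i: "A $ i = B $ i + 1"
begin

abbreviation transversal_weight :: "real ^ 'n minus_one \<Rightarrow> real" where
  "transversal_weight \<equiv> monomial_weight (drop_coord i B)"

lemma A_i_ge_1: "1 \<le> A $ i" using A_i B_nonneg[of i] by simp

lemma drop_A: "drop_coord i A = drop_coord i B"
  using A_eq_B coord_neq[OF card_ge_2] by (simp add: vec_eq_iff drop_coord_nth[OF card_ge_2])

lemma weight_A: "monomial_weight A x = \<bar>x $ i\<bar> powr (A $ i) * transversal_weight (drop_coord i x)"
  using monomial_weight_coord[OF card_ge_2, of A x i] A_i_ge_1 drop_A by auto

lemma weight_B:
  assumes "x $ i \<noteq> 0"
  shows "monomial_weight B x = \<bar>x $ i\<bar> powr (A $ i - 1) * transversal_weight (drop_coord i x)"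
  using monomial_weight_coord[OF card_ge_2, of B x i] A_i assms by auto

text \<open>The parameter \<open>s\<close> is a sign: \<open>s = 1\<close> and \<open>s = -1\<close> treat the two sides of the hyperplane
  \<open>x $ i = 0\<close> at once.\<close>

lemma volume_by_slices:
  fixes \<Omega> :: "(real ^ 'n) set"
  assumes s: "\<bar>s\<bar> = 1" and [measurable]: "\<Omega> \<in> sets borel" and e: "0 \<le> e"
  shows "ennreal (A $ i) * (\<integral>\<^sup>+x. ennreal (monomial_weight B x) * indicator (\<Omega> \<inter> {x. e < s * x $ i}) x \<partial>lborel)
    = (\<integral>\<^sup>+v. ennreal (transversal_weight v) *
        emeasure (power_measure (A $ i)) ({r. insert_coord i v (s * r) \<in> \<Omega>} \<inter> {e<..}) \<partial>lborel)" (is "_ * ?L = ?R")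
    and "(\<lambda>v. emeasure (power_measure (A $ i)) ({r. insert_coord i v (s * r) \<in> \<Omega>} \<inter> {e<..}))
        \<in> borel_measurable borel"
proof -
  let ?a = "A $ i"
  note [measurable] = borel_measurable_insert_coord[OF card_ge_2]
  have ss: "s * (s * r) = r" for r using s by (auto simp: abs_if split: if_splits)
  have mass: "emeasure (power_measure ?a) ({r. insert_coord i v (s * r) \<in> \<Omega>} \<inter> {e<..})
     = (\<integral>\<^sup>+r. ennreal (?a * r powr (?a - 1)) * (indicator \<Omega> (insert_coord i v (s * r)) * indicator {e<..} r) \<partial>lborel)" for v
  proof -
    have "{r. insert_coord i v (s * r) \<in> \<Omega>} \<in> sets borel" by measurable
    then show ?thesis unfolding power_measure_def
      by (subst emeasure_density) (auto intro!: nn_integral_cong simp: indicator_def)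
  qed
  show "(\<lambda>v. emeasure (power_measure ?a) ({r. insert_coord i v (s * r) \<in> \<Omega>} \<inter> {e<..}))
        \<in> borel_measurable borel"
    unfolding mass by measurable
  have "?L = (\<integral>\<^sup>+v. \<integral>\<^sup>+t. ennreal (monomial_weight B (insert_coord i v t)) *
      indicator (\<Omega> \<inter> {x. e < s * x $ i}) (insert_coord i v t) \<partial>lborel \<partial>lborel)"
    by (rule nn_integral_insert_coord[OF card_ge_2]) measurable
  also have "\<dots> = (\<integral>\<^sup>+v. \<integral>\<^sup>+r. ennreal (monomial_weight B (insert_coord i v (s * r))) *
      indicator (\<Omega> \<inter> {x. e < s * x $ i}) (insert_coord i v (s * r)) \<partial>lborel \<partial>lborel)"
  proof (rule nn_integral_cong)
    fix v
    show "(\<integral>\<^sup>+t. ennreal (monomial_weight B (insert_coord i v t)) *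
      indicator (\<Omega> \<inter> {x. e < s * x $ i}) (insert_coord i v t) \<partial>lborel)
      = (\<integral>\<^sup>+r. ennreal (monomial_weight B (insert_coord i v (s * r))) *
      indicator (\<Omega> \<inter> {x. e < s * x $ i}) (insert_coord i v (s * r)) \<partial>lborel)"
      using s by (subst nn_integral_real_affine[where c = s and t = 0]) auto
  qed
  also have "ennreal ?a * \<dots> = (\<integral>\<^sup>+v. \<integral>\<^sup>+r. ennreal ?a * (ennreal (monomial_weight B (insert_coord i v (s * r))) *
      indicator (\<Omega> \<inter> {x. e < s * x $ i}) (insert_coord i v (s * r))) \<partial>lborel \<partial>lborel)"
    by (simp add: nn_integral_cmult)
  also have "\<dots> = (\<integral>\<^sup>+v. \<integral>\<^sup>+r. ennreal (transversal_weight v) * (ennreal (?a * r powr (?a - 1)) *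
      (indicator \<Omega> (insert_coord i v (s * r)) * indicator {e<..} r)) \<partial>lborel \<partial>lborel)"
  proof (intro nn_integral_cong)
    fix v r
    show "ennreal ?a * (ennreal (monomial_weight B (insert_coord i v (s * r))) *
      indicator (\<Omega> \<inter> {x. e < s * x $ i}) (insert_coord i v (s * r)))
      = ennreal (transversal_weight v) * (ennreal (?a * r powr (?a - 1)) *
      (indicator \<Omega> (insert_coord i v (s * r)) * indicator {e<..} r))"
    proof (cases "e < r")
      case True
      then have "0 < r" using e by simp
      then have "monomial_weight B (insert_coord i v (s * r)) = r powr (?a - 1) * transversal_weight v"
        using s by (subst weight_B) (auto simp: insert_coord_nth[OF card_ge_2] drop_insert_coord[OF card_ge_2] abs_mult)
      moreover have "ennreal ?a * ennreal (r powr (?a - 1) * transversal_weight v)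
        = ennreal (transversal_weight v) * ennreal (?a * r powr (?a - 1))"
        using A_i_ge_1 by (simp add: ennreal_mult[symmetric] monomial_weight_nonneg mult_ac)
      ultimately show ?thesis using True
        by (simp add: indicator_def insert_coord_nth[OF card_ge_2] ss)
    next
      case False
      then show ?thesis by (simp add: insert_coord_nth[OF card_ge_2] ss)
    qed
  qed
  also have "\<dots> = ?R" unfolding mass by (simp add: nn_integral_cmult)
  finally show "ennreal (A $ i) * ?L = ?R" .
qed

text \<open>The one-dimensional estimate on almost every line, integrated over all lines. Away from the
  hyperplane \<open>x $ i = 0\<close> a geometric grid is available. On each of its slabs the perimeter weight
  changes along a line at most by the factor \<open>q powr a\<close>, the same for all slabs; an
  arithmetic grid gives no such uniform factor.\<close>

lemma volume_le_perimeter_far_from_hyperplane: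
  fixes \<Omega> :: "(real ^ 'n) set"
  assumes s: "\<bar>s\<bar> = 1" and \<Omega>: "open \<Omega>" and fin: "weighted_volume B \<Omega> < \<infinity>" and e: "0 < e" and q: "1 < q"
  shows "ennreal (A $ i) * (\<integral>\<^sup>+x. ennreal (monomial_weight B x) * indicator (\<Omega> \<inter> {x. e < s * x $ i}) x \<partial>lborel)
    \<le> ennreal (q powr (A $ i)) *
      (\<integral>\<^sup>+x. ennreal (monomial_weight A x) * indicator (frontier \<Omega> \<inter> {x. 0 < s * x $ i}) x \<partial>hausdorff (CARD('n) - 1))"
proof -
  let ?a = "A $ i" and ?W = transversal_weight and ?H = "hausdorff (CARD('n) - 1) :: (real ^ 'n) measure"
  note [measurable] = borel_measurable_insert_coord[OF card_ge_2] borel_measurable_drop_coord[OF card_ge_2]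
  have ss: "s * (s * r) = r" for r using s by (auto simp: abs_if split: if_splits)
  have [measurable]: "\<Omega> \<in> sets borel" "frontier \<Omega> \<in> sets borel" using \<Omega> by auto
  define t where "t n = e * q ^ n" for n :: nat
  have tpos: "0 < t n" and tless: "t n < t (Suc n)" and tSuc: "t (Suc n) = q * t n" for n
    using e q by (auto simp: t_def)
  have ttop: "filterlim t at_top sequentially"
    unfolding t_def using e q
    by (intro filterlim_tendsto_pos_mult_at_top[OF tendsto_const]
        filterlim_at_infinity_imp_filterlim_at_top filterlim_realpow_sequentially_gt1) auto
  have tmono: "t k \<le> t n" if "k \<le> n" for k n
    by (rule lift_Suc_mono_le[of t, OF less_imp_le[OF tless] that])
  define Z where "Z k = frontier \<Omega> \<inter> {x. t k < s * x $ i \<and> s * x $ i \<le> t (Suc k)}" for k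
  define E where "E k = drop_coord i ` Z k" for k
  have [measurable]: "Z k \<in> sets borel" for k unfolding Z_def by measurable
  have [measurable]: "E k \<in> sets borel" for k
    unfolding E_def Z_def by (rule borel_drop_coord_strip[OF card_ge_2]) simp
  define g where "g v = emeasure (power_measure ?a) ({r. insert_coord i v (s * r) \<in> \<Omega>} \<inter> {e<..})" for v
  have [measurable]: "g \<in> borel_measurable borel"
    unfolding g_def using e by (intro volume_by_slices(2) s) auto
  have slice: "g v \<le> (\<Sum>k. ennreal (t (Suc k) powr ?a) * indicator (E k) v)" if "g v \<noteq> \<infinity>" for v
  proof -
    let ?F = "{r. insert_coord i v (s * r) \<in> frontier \<Omega>}"
    have t0: "t 0 = e" by (simp add: t_def)
    have "g v \<le> (\<Sum>k. ennreal (t (Suc k) powr ?a) * of_bool (?F \<inter> {t k<..t (Suc k)} \<noteq> {}))"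
      unfolding g_def t0[symmetric]
      using that e open_slice[OF card_ge_2 \<Omega>] frontier_slice_subset[OF card_ge_2 \<Omega>] A_i_ge_1 tpos tless ttop
      by (intro emeasure_power_measure_open_le) (auto simp: g_def t0)
    also have "\<dots> \<le> (\<Sum>k. ennreal (t (Suc k) powr ?a) * indicator (E k) v)"
    proof (intro suminf_le mult_left_mono)
      fix k
      show "of_bool (?F \<inter> {t k<..t (Suc k)} \<noteq> {}) \<le> (indicator (E k) v :: ennreal)"
      proof (cases "?F \<inter> {t k<..t (Suc k)} = {}")
        case False
        then obtain r where "insert_coord i v (s * r) \<in> frontier \<Omega>" "t k < r" "r \<le> t (Suc k)" by auto
        then have "insert_coord i v (s * r) \<in> Z k"
          by (simp add: Z_def insert_coord_nth[OF card_ge_2] ss)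
        then have "drop_coord i (insert_coord i v (s * r)) \<in> E k" unfolding E_def by (rule imageI)
        then have "v \<in> E k" by (simp add: drop_insert_coord[OF card_ge_2])
        then show ?thesis by simp
      qed simp
    qed auto
    finally show ?thesis .
  qed
  have vol: "ennreal ?a * (\<integral>\<^sup>+x. ennreal (monomial_weight B x) * indicator (\<Omega> \<inter> {x. e < s * x $ i}) x \<partial>lborel)
      = (\<integral>\<^sup>+v. ennreal (?W v) * g v \<partial>lborel)" (is "?V = _")
    unfolding g_def using e by (intro volume_by_slices(1) s) auto
  have "?V \<le> ennreal ?a * weighted_volume B \<Omega>"
    unfolding weighted_volume_def
    by (intro mult_left_mono nn_integral_mono) (auto simp: indicator_def)
  also have "\<dots> < \<infinity>" using fin by (simp add: ennreal_mult_less_top)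
  finally have "(\<integral>\<^sup>+v. ennreal (?W v) * g v \<partial>lborel) \<noteq> \<infinity>" unfolding vol by simp
  \<comment> \<open>Almost every slice on which the transversal weight does not vanish has finite mass.\<close>
  then have AE: "AE v in lborel. ennreal (?W v) * g v \<noteq> \<infinity>"
    by (intro nn_integral_PInf_AE) auto
  have "?V \<le> (\<integral>\<^sup>+v. ennreal (?W v) * (\<Sum>k. ennreal (t (Suc k) powr ?a) * indicator (E k) v) \<partial>lborel)"
    unfolding vol
  proof (rule nn_integral_mono_AE, use AE in eventually_elim)
    fix v assume *: "ennreal (?W v) * g v \<noteq> \<infinity>"
    show "ennreal (?W v) * g v \<le> ennreal (?W v) * (\<Sum>k. ennreal (t (Suc k) powr ?a) * indicator (E k) v)"
    proof (cases "ennreal (?W v) = 0")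
      case False
      then have "g v \<noteq> \<infinity>" using * by (auto simp: ennreal_mult_eq_top_iff)
      then show ?thesis by (intro mult_left_mono slice) auto
    qed simp
  qed
  also have "\<dots> = (\<Sum>k. ennreal (t (Suc k) powr ?a) * (\<integral>\<^sup>+v. ennreal (?W v) * indicator (E k) v \<partial>lborel))"
    by (simp add: ennreal_suminf_cmult[symmetric] nn_integral_suminf nn_integral_cmult[symmetric] mult_ac
      del: ennreal_suminf_cmult)
  also have "\<dots> \<le> (\<Sum>k. \<integral>\<^sup>+x. ennreal (q powr ?a) * ennreal (monomial_weight A x) * indicator (Z k) x \<partial>?H)"
  proof (intro suminf_le)
    fix k
    have sub: "E k \<subseteq> drop_coord i ` Z k" by (simp add: E_def)
    have "(\<integral>\<^sup>+v. ennreal (?W v) * indicator (E k) v \<partial>lborel) \<le> (\<integral>\<^sup>+x. ennreal (?W (drop_coord i x)) * indicator (Z k) x \<partial>?H)"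
      by (rule nn_integral_drop_coord_le[OF card_ge_2 _ _ _ sub]) measurable
    then have "ennreal (t (Suc k) powr ?a) * (\<integral>\<^sup>+v. ennreal (?W v) * indicator (E k) v \<partial>lborel)
      \<le> ennreal (t (Suc k) powr ?a) * (\<integral>\<^sup>+x. ennreal (?W (drop_coord i x)) * indicator (Z k) x \<partial>?H)"
      by (rule mult_left_mono) simp
    also have "\<dots> = (\<integral>\<^sup>+x. ennreal (t (Suc k) powr ?a) * (ennreal (?W (drop_coord i x)) * indicator (Z k) x) \<partial>?H)"
      by (rule nn_integral_cmult[symmetric]) measurable
    also have "\<dots> \<le> (\<integral>\<^sup>+x. ennreal (q powr ?a) * ennreal (monomial_weight A x) * indicator (Z k) x \<partial>?H)"
    proof (rule nn_integral_mono)
      fix x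
      show "ennreal (t (Suc k) powr ?a) * (ennreal (?W (drop_coord i x)) * indicator (Z k) x)
        \<le> ennreal (q powr ?a) * ennreal (monomial_weight A x) * indicator (Z k) x"
      proof (cases "x \<in> Z k")
        case True
        then have "t k < s * x $ i" by (simp add: Z_def)
        moreover have "s * x $ i \<le> \<bar>x $ i\<bar>" using abs_ge_self[of "s * x $ i"] s by (simp add: abs_mult)
        ultimately have "t k powr ?a \<le> \<bar>x $ i\<bar> powr ?a"
          using tpos[of k] A_i_ge_1 by (intro powr_mono2) auto
        then have "t (Suc k) powr ?a * ?W (drop_coord i x) \<le> q powr ?a * monomial_weight A x"
          using tpos[of k] q unfolding tSuc weight_A
          by (simp add: powr_mult mult.assoc mult_left_mono mult_right_mono monomial_weight_nonneg)
        then show ?thesis using True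
          by (simp add: ennreal_mult[symmetric] monomial_weight_nonneg ennreal_leI)
      qed simp
    qed
    finally show "ennreal (t (Suc k) powr ?a) * (\<integral>\<^sup>+v. ennreal (?W v) * indicator (E k) v \<partial>lborel)
      \<le> (\<integral>\<^sup>+x. ennreal (q powr ?a) * ennreal (monomial_weight A x) * indicator (Z k) x \<partial>?H)" .
  qed auto
  also have "\<dots> = (\<integral>\<^sup>+x. ennreal (q powr ?a) * (ennreal (monomial_weight A x) * (\<Sum>k. indicator (Z k) x)) \<partial>?H)"
    by (simp add: nn_integral_suminf[symmetric] ennreal_suminf_cmult[symmetric] mult.assoc del: ennreal_suminf_cmult)
  also have "\<dots> \<le> (\<integral>\<^sup>+x. ennreal (q powr ?a) * (ennreal (monomial_weight A x) * indicator (frontier \<Omega> \<inter> {x. 0 < s * x $ i}) x) \<partial>?H)"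
  proof (intro nn_integral_mono mult_left_mono)
    fix x
    have "disjoint_family Z"
      unfolding disjoint_family_on_def
    proof (intro ballI impI)
      fix k l :: nat assume "k \<noteq> l"
      then consider "Suc k \<le> l" | "Suc l \<le> k" by linarith
      then show "Z k \<inter> Z l = {}"
        by cases (use tmono[of "Suc k" l] tmono[of "Suc l" k] in \<open>auto simp: Z_def\<close>)
    qed
    then have "(\<Sum>k. indicator (Z k) x :: ennreal) = indicator (\<Union>k. Z k) x"
      by (rule suminf_indicator)
    also have "\<dots> \<le> indicator (frontier \<Omega> \<inter> {x. 0 < s * x $ i}) x"
      using tpos by (auto simp: Z_def intro: less_trans)
    finally show "(\<Sum>k. indicator (Z k) x :: ennreal) \<le> indicator (frontier \<Omega> \<inter> {x. 0 < s * x $ i}) x" .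
  qed auto
  also have "\<dots> = ennreal (q powr ?a) * (\<integral>\<^sup>+x. ennreal (monomial_weight A x) * indicator (frontier \<Omega> \<inter> {x. 0 < s * x $ i}) x \<partial>?H)"
    by (rule nn_integral_cmult) measurable
  finally show ?thesis .
qed

lemma weighted_volume_halfspaces:
  fixes \<Omega> :: "(real ^ 'n) set"
  assumes [measurable]: "\<Omega> \<in> sets borel"
  shows "weighted_volume B \<Omega>
    = (\<integral>\<^sup>+x. ennreal (monomial_weight B x) * indicator (\<Omega> \<inter> {x. 0 < 1 * x $ i}) x \<partial>lborel)
      + (\<integral>\<^sup>+x. ennreal (monomial_weight B x) * indicator (\<Omega> \<inter> {x. 0 < (-1) * x $ i}) x \<partial>lborel)"
    (is "_ = ?V 1 + ?V (-1)")
proof -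
  have "weighted_volume B \<Omega> = (\<integral>\<^sup>+x. ennreal (monomial_weight B x) * indicator (\<Omega> \<inter> {x. 0 < 1 * x $ i}) x
      + ennreal (monomial_weight B x) * indicator (\<Omega> \<inter> {x. 0 < (-1) * x $ i}) x \<partial>lborel)"
    unfolding weighted_volume_def
    by (intro nn_integral_cong_AE, use AE_nth_neq_0[of i] in eventually_elim) (auto simp: indicator_def)
  also have "\<dots> = ?V 1 + ?V (-1)" by (rule nn_integral_add) measurable
  finally show ?thesis .
qed

text \<open>The distance \<open>e\<close> to the hyperplane and the mesh \<open>q\<close> are sent to their limits along one
  sequence, \<open>e = 1 / (n + 1)\<close> and \<open>q = 1 + 1 / (n + 1)\<close>.\<close>

lemma volume_le_perimeter_halfspace:
  fixes \<Omega> :: "(real ^ 'n) set"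
  assumes s: "\<bar>s\<bar> = 1" and \<Omega>: "open \<Omega>" and fin: "weighted_volume B \<Omega> < \<infinity>"
  shows "ennreal (A $ i) * (\<integral>\<^sup>+x. ennreal (monomial_weight B x) * indicator (\<Omega> \<inter> {x. 0 < s * x $ i}) x \<partial>lborel)
    \<le> (\<integral>\<^sup>+x. ennreal (monomial_weight A x) * indicator (frontier \<Omega> \<inter> {x. 0 < s * x $ i}) x \<partial>hausdorff (CARD('n) - 1))"
    (is "_ * ?V \<le> ?P")
proof (cases "?P = \<infinity>")
  case False
  have [measurable]: "\<Omega> \<in> sets borel" using \<Omega> by auto
  let ?e = "\<lambda>n. 1 / real (Suc n)"
  let ?M = "density lborel (\<lambda>x. ennreal (monomial_weight B x))"
  have M: "(\<integral>\<^sup>+x. ennreal (monomial_weight B x) * indicator S x \<partial>lborel) = emeasure ?M S" if "S \<in> sets borel" for S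
    using that by (simp add: emeasure_density)
  have [measurable]: "\<Omega> \<inter> {x. c < s * x $ i} \<in> sets borel" for c by measurable
  have "(\<lambda>n. emeasure ?M (\<Omega> \<inter> {x. ?e n < s * x $ i})) \<longlonglongrightarrow> emeasure ?M (\<Union>n. \<Omega> \<inter> {x. ?e n < s * x $ i})"
  proof (rule Lim_emeasure_incseq)
    have "?e (Suc n) \<le> ?e n" for n by (simp add: field_simps)
    then show "incseq (\<lambda>n. \<Omega> \<inter> {x. ?e n < s * x $ i})"
      by (intro incseq_SucI) (auto intro: le_less_trans)
  qed auto
  moreover have "(\<Union>n. \<Omega> \<inter> {x. ?e n < s * x $ i}) = \<Omega> \<inter> {x. 0 < s * x $ i}"
  proof -
    have "(\<exists>n. ?e n < y) \<longleftrightarrow> 0 < y" for y :: real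
      using reals_Archimedean[of y] by (auto simp: inverse_eq_divide intro: less_trans[rotated])
    then show ?thesis by blast
  qed
  ultimately have "(\<lambda>n. emeasure ?M (\<Omega> \<inter> {x. ?e n < s * x $ i})) \<longlonglongrightarrow> ?V"
    by (simp add: M)
  then have "(\<lambda>n. ennreal (A $ i) * emeasure ?M (\<Omega> \<inter> {x. ?e n < s * x $ i})) \<longlonglongrightarrow> ennreal (A $ i) * ?V"
    by (rule ennreal_tendsto_cmult[rotated]) simp
  moreover have "(\<lambda>n. ?P * ennreal ((1 + ?e n) powr (A $ i))) \<longlonglongrightarrow> ?P * ennreal ((1 + 0) powr (A $ i))"
    using False A_i_ge_1
    by (intro ennreal_tendsto_cmult tendsto_ennrealI tendsto_powr tendsto_add tendsto_const LIMSEQ_Suc[OF lim_1_over_n])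
       (auto simp: less_top)
  moreover have "ennreal (A $ i) * emeasure ?M (\<Omega> \<inter> {x. ?e n < s * x $ i}) \<le> ?P * ennreal ((1 + ?e n) powr (A $ i))" for n
    using volume_le_perimeter_far_from_hyperplane[OF s \<Omega> fin, of "?e n" "1 + ?e n"] by (simp add: M mult.commute)
  ultimately show ?thesis by (auto intro: LIMSEQ_le)
qed simp

theorem volume_le_perimeter:
  fixes \<Omega> :: "(real ^ 'n) set"
  assumes \<Omega>: "open \<Omega>" and fin: "weighted_volume B \<Omega> < \<infinity>"
  shows "ennreal (A $ i) * weighted_volume B \<Omega> \<le> weighted_perimeter A \<Omega>"
proof -
  let ?H = "hausdorff (CARD('n) - 1) :: (real ^ 'n) measure"
  have [measurable]: "\<Omega> \<in> sets borel" "frontier \<Omega> \<in> sets borel" using \<Omega> by auto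
  let ?V = "\<lambda>s. \<integral>\<^sup>+x. ennreal (monomial_weight B x) * indicator (\<Omega> \<inter> {x. 0 < s * x $ i}) x \<partial>lborel"
  let ?P = "\<lambda>s. \<integral>\<^sup>+x. ennreal (monomial_weight A x) * indicator (frontier \<Omega> \<inter> {x. 0 < s * x $ i}) x \<partial>?H"
  have "ennreal (A $ i) * weighted_volume B \<Omega> = ennreal (A $ i) * ?V 1 + ennreal (A $ i) * ?V (-1)"
    by (subst weighted_volume_halfspaces) (simp_all add: distrib_left)
  also have "\<dots> \<le> ?P 1 + ?P (-1)"
    by (intro add_mono volume_le_perimeter_halfspace \<Omega> fin) auto
  also have "\<dots> = (\<integral>\<^sup>+x. ennreal (monomial_weight A x) * indicator (frontier \<Omega> \<inter> {x. 0 < 1 * x $ i}) x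
      + ennreal (monomial_weight A x) * indicator (frontier \<Omega> \<inter> {x. 0 < (-1) * x $ i}) x \<partial>?H)"
    by (rule nn_integral_add[symmetric]) measurable
  also have "\<dots> \<le> weighted_perimeter A \<Omega>"
    unfolding weighted_perimeter_def by (intro nn_integral_mono) (auto simp: indicator_def)
  finally show ?thesis .
qed

end

section \<open>Smooth functions and decaying profiles\<close>

text \<open>The iterated derivatives are formed with \<open>frechet_derivative\<close>, which is known in
  closed form only on \<open>S\<close>. Closure properties of \<open>C_k_on\<close> hence rely on its invariance under changes of the
  function off the open set \<open>S\<close>.\<close>

lemma C_k_on_cong:
  fixes f g :: "'a::euclidean_space \<Rightarrow> real"
  assumes "open S" "\<And>x. x \<in> S \<Longrightarrow> f x = g x" "C_k_on k f S"
  shows "C_k_on k g S"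
  using assms(2,3)
proof (induction k arbitrary: f g)
  case 0
  then show ?case by (simp cong: continuous_on_cong)
next
  case (Suc k)
  have der: "(g has_derivative frechet_derivative f (at x)) (at x)" if "x \<in> S" for x
  proof (rule has_derivative_transform_within_open[OF _ assms(1) that Suc.prems(1)])
    show "(f has_derivative frechet_derivative f (at x)) (at x)"
      using Suc.prems(2) that frechet_derivative_works by auto
  qed
  have "C_k_on k (\<lambda>x. frechet_derivative g (at x) b) S" if "b \<in> Basis" for b
  proof (rule Suc.IH[of "\<lambda>x. frechet_derivative f (at x) b"])
    show "frechet_derivative f (at x) b = frechet_derivative g (at x) b" if "x \<in> S" for x
      using frechet_derivative_at[OF der[OF that]] by simp
  qed (use Suc.prems(2) that in auto)
  then show ?case using der by (auto simp: differentiable_def)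
qed

lemma C_k_on_SucI:
  fixes f :: "'a::euclidean_space \<Rightarrow> real"
  assumes S: "open S" and f: "\<And>x. x \<in> S \<Longrightarrow> (f has_derivative f' x) (at x)"
    and f': "\<And>b. b \<in> Basis \<Longrightarrow> C_k_on k (\<lambda>x. f' x b) S"
  shows "C_k_on (Suc k) f S"
proof -
  have "C_k_on k (\<lambda>x. frechet_derivative f (at x) b) S" if "b \<in> Basis" for b
  proof (rule C_k_on_cong[OF S _ f'[OF that]])
    show "f' x b = frechet_derivative f (at x) b" if "x \<in> S" for x
      using frechet_derivative_at[OF f[OF that]] by simp
  qed
  then show ?thesis using f by (auto simp: differentiable_def)
qed

lemma C_k_on_Suc_has_derivative:
  "C_k_on (Suc k) f S \<Longrightarrow> x \<in> S \<Longrightarrow> (f has_derivative frechet_derivative f (at x)) (at x)"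
  by (auto simp: frechet_derivative_works)

lemma C_k_on_SucD: "C_k_on (Suc k) f S \<Longrightarrow> C_k_on k f S"
proof (induction k arbitrary: f)
  case 0
  then show ?case
    by (auto intro: continuous_at_imp_continuous_on differentiable_imp_continuous_within)
next
  case (Suc k)
  from Suc.prems have "\<forall>x\<in>S. f differentiable at x"
    "\<And>b. b \<in> Basis \<Longrightarrow> C_k_on (Suc k) (\<lambda>x. frechet_derivative f (at x) b) S" by auto
  then show ?case using Suc.IH by simp
qed

lemma C_k_on_const: "open S \<Longrightarrow> C_k_on k (\<lambda>x. c) S"
proof (induction k arbitrary: c)
  case (Suc k)
  then show ?case
    by (intro C_k_on_SucI[where f' = "\<lambda>_ _. 0"]) (auto intro!: derivative_eq_intros)
qed simp

lemma C_k_on_bounded_linear: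
  assumes "open S" "bounded_linear f"
  shows "C_k_on k f S"
proof (cases k)
  case 0
  then show ?thesis using assms by (simp add: linear_continuous_on)
next
  case (Suc m)
  have "C_k_on (Suc m) f S"
    using assms by (intro C_k_on_SucI[where f' = "\<lambda>_. f"] C_k_on_const bounded_linear_imp_has_derivative)
  then show ?thesis using Suc by simp
qed

lemma C_k_on_add: "open S \<Longrightarrow> C_k_on k f S \<Longrightarrow> C_k_on k g S \<Longrightarrow> C_k_on k (\<lambda>x. f x + g x) S"
proof (induction k arbitrary: f g)
  case 0
  then show ?case by (simp add: continuous_on_add)
next
  case (Suc k)
  show ?case
  proof (rule C_k_on_SucI[OF Suc.prems(1)])
    show "((\<lambda>x. f x + g x) has_derivative
        (\<lambda>h. frechet_derivative f (at x) h + frechet_derivative g (at x) h)) (at x)" if "x \<in> S" for x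
      using C_k_on_Suc_has_derivative[OF Suc.prems(2) that] C_k_on_Suc_has_derivative[OF Suc.prems(3) that]
      by (rule has_derivative_add)
    show "C_k_on k (\<lambda>x. frechet_derivative f (at x) b + frechet_derivative g (at x) b) S"
      if "b \<in> Basis" for b
      using Suc.prems that by (intro Suc.IH) auto
  qed
qed

lemma C_k_on_mult: "open S \<Longrightarrow> C_k_on k f S \<Longrightarrow> C_k_on k g S \<Longrightarrow> C_k_on k (\<lambda>x. f x * g x) S"
proof (induction k arbitrary: f g)
  case 0
  then show ?case by (simp add: continuous_on_mult)
next
  case (Suc k)
  show ?case
  proof (rule C_k_on_SucI[OF Suc.prems(1)])
    show "((\<lambda>x. f x * g x) has_derivative
        (\<lambda>h. f x * frechet_derivative g (at x) h + frechet_derivative f (at x) h * g x)) (at x)" if "x \<in> S" for x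
      using C_k_on_Suc_has_derivative[OF Suc.prems(2) that] C_k_on_Suc_has_derivative[OF Suc.prems(3) that]
      by (rule has_derivative_mult)
    show "C_k_on k (\<lambda>x. f x * frechet_derivative g (at x) b + frechet_derivative f (at x) b * g x) S"
      if "b \<in> Basis" for b
      using Suc.prems that C_k_on_SucD[OF Suc.prems(2)] C_k_on_SucD[OF Suc.prems(3)]
      by (intro C_k_on_add Suc.IH) auto
  qed
qed

lemma C_k_on_power: "open S \<Longrightarrow> C_k_on k f S \<Longrightarrow> C_k_on k (\<lambda>x. f x ^ n) S"
  by (induction n) (simp_all add: C_k_on_const C_k_on_mult)

lemma C_k_on_sum: "open S \<Longrightarrow> (\<And>i. i \<in> I \<Longrightarrow> C_k_on k (f i) S) \<Longrightarrow> C_k_on k (\<lambda>x. \<Sum>i\<in>I. f i x) S"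
  by (induction I rule: infinite_finite_induct) (simp_all add: C_k_on_const C_k_on_add)

lemma nn_integral_inverse_one_plus_square_finite:
  "(\<integral>\<^sup>+x. ennreal (1 / (1 + x\<^sup>2)) \<partial>lborel) < (\<infinity>::ennreal)"
proof -
  let ?f = "\<lambda>x::real. 1 / (1 + x\<^sup>2)"
  have nz: "1 + x\<^sup>2 \<noteq> 0" for x :: real by (simp add: add_nonneg_eq_0_iff)
  have "(\<integral>\<^sup>+x. ennreal (?f x) * indicator {0..} x \<partial>lborel) = ennreal (pi / 2 - arctan 0)"
  proof (rule nn_integral_FTC_atLeast)
    show "(arctan has_real_derivative ?f x) (at x)" for x
      using DERIV_arctan[of x] by (simp add: inverse_eq_divide)
    show "(arctan \<longlongrightarrow> pi / 2) at_top" by (rule tendsto_arctan_at_top)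
  qed auto
  then have half: "(\<integral>\<^sup>+x. ennreal (?f x) * indicator {0..} x \<partial>lborel) < \<infinity>" by simp
  have "(\<integral>\<^sup>+x. ennreal (?f x) * indicator {..0} x \<partial>lborel)
      = (\<integral>\<^sup>+x. ennreal (?f x) * indicator {0..} x \<partial>lborel)"
    by (subst nn_integral_real_affine[where c = "-1" and t = 0]) (auto simp: indicator_def)
  with half have half': "(\<integral>\<^sup>+x. ennreal (?f x) * indicator {..0} x \<partial>lborel) < \<infinity>" by simp
  have "(\<integral>\<^sup>+x. ennreal (?f x) \<partial>lborel)
      \<le> (\<integral>\<^sup>+x. ennreal (?f x) * indicator {0..} x + ennreal (?f x) * indicator {..0} x \<partial>lborel)"
    by (intro nn_integral_mono) (auto simp: indicator_def)
  also have "\<dots> = (\<integral>\<^sup>+x. ennreal (?f x) * indicator {0..} x \<partial>lborel)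
      + (\<integral>\<^sup>+x. ennreal (?f x) * indicator {..0} x \<partial>lborel)"
    by (intro nn_integral_add) auto
  also have "\<dots> < \<infinity>" using half half' by simp
  finally show ?thesis .
qed

text \<open>The integrand is dominated by a product of functions of one variable.\<close>

lemma nn_integral_inverse_one_plus_norm_power_finite:
  "(\<integral>\<^sup>+v. ennreal (1 / (1 + (norm (v::'a::euclidean_space))\<^sup>2) ^ DIM('a)) \<partial>lborel) < (\<infinity>::ennreal)"
proof -
  have "(\<integral>\<^sup>+v. ennreal (1 / (1 + (norm v)\<^sup>2) ^ DIM('a)) \<partial>(lborel :: 'a measure))
      \<le> (\<integral>\<^sup>+v. (\<Prod>b\<in>Basis. ennreal (1 / (1 + (v \<bullet> b)\<^sup>2))) \<partial>(lborel :: 'a measure))"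
  proof (rule nn_integral_mono)
    fix v :: 'a
    have pos: "0 < 1 + (v \<bullet> b)\<^sup>2" for b by (simp add: add_pos_nonneg)
    have "(\<Prod>b\<in>Basis. 1 + (v \<bullet> b)\<^sup>2) \<le> (\<Prod>b\<in>(Basis::'a set). 1 + (norm v)\<^sup>2)"
    proof (rule prod_mono)
      fix b :: 'a assume b: "b \<in> Basis"
      then have "\<bar>v \<bullet> b\<bar> \<le> norm v" by (rule Basis_le_norm)
      then have "(v \<bullet> b)\<^sup>2 \<le> (norm v)\<^sup>2" using abs_le_square_iff[of "v \<bullet> b" "norm v"] by simp
      then show "0 \<le> 1 + (v \<bullet> b)\<^sup>2 \<and> 1 + (v \<bullet> b)\<^sup>2 \<le> 1 + (norm v)\<^sup>2" by simp
    qed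
    then have le: "(\<Prod>b\<in>Basis. 1 + (v \<bullet> b)\<^sup>2) \<le> (1 + (norm v)\<^sup>2) ^ DIM('a)" by simp
    have "1 / (1 + (norm v)\<^sup>2) ^ DIM('a) \<le> 1 / (\<Prod>b\<in>Basis. 1 + (v \<bullet> b)\<^sup>2)"
      by (rule divide_left_mono[OF le])
         (auto intro!: mult_pos_pos prod_pos zero_less_power pos simp: add_pos_nonneg)
    also have "\<dots> = (\<Prod>b\<in>Basis. 1 / (1 + (v \<bullet> b)\<^sup>2))" by (simp add: prod_dividef)
    finally show "ennreal (1 / (1 + (norm v)\<^sup>2) ^ DIM('a)) \<le> (\<Prod>b\<in>Basis. ennreal (1 / (1 + (v \<bullet> b)\<^sup>2)))"
      by (subst prod_ennreal) (auto intro: ennreal_leI)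
  qed
  also have "\<dots> = (\<Prod>b\<in>(Basis::'a set). \<integral>\<^sup>+x. ennreal (1 / (1 + x\<^sup>2)) \<partial>lborel)"
    by (rule nn_integral_lborel_prod) auto
  also have "\<dots> < \<infinity>"
    using nn_integral_inverse_one_plus_square_finite by (simp add: power_less_top_ennreal)
  finally show ?thesis .
qed

lemma emeasure_power_measure_Ioo:
  assumes "0 < a" "0 \<le> u"
  shows "emeasure (power_measure a) {0<..<u} = ennreal (u powr a)"
proof -
  have "emeasure (power_measure a) {0, u} = 0"
    unfolding power_measure_def by (rule null_setsD1) (intro absolutely_continuousI_density[unfolded absolutely_continuous_def, THEN subsetD], auto intro: countable_imp_null_set_lborel)
  then have null: "{0, u} \<in> null_sets (power_measure a)" by (simp add: null_sets_def)
  have "emeasure (power_measure a) {0<..<u} = emeasure (power_measure a) ({0..u} - {0, u})"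
    by (rule arg_cong[where f = "emeasure (power_measure a)"]) auto
  also have "\<dots> = emeasure (power_measure a) {0..u}"
    using null by (intro emeasure_Diff_null_set) auto
  finally show ?thesis using assms by (simp add: emeasure_power_measure_Icc)
qed

lemma inverse_one_plus_norm_square_lipschitz:
  fixes v w :: "'a::real_normed_vector"
  shows "\<bar>1 / (1 + (norm v)\<^sup>2) - 1 / (1 + (norm w)\<^sup>2)\<bar> \<le> norm (v - w)"
proof -
  define x y where "x = norm v" and "y = norm w"
  have xy: "0 \<le> x" "0 \<le> y" by (auto simp: x_def y_def)
  have px: "0 < 1 + x\<^sup>2" "0 < 1 + y\<^sup>2" by (auto simp: add_pos_nonneg)
  have "x + y \<le> (1 + x\<^sup>2) * (1 + y\<^sup>2)"
  proof -
    have "p \<le> (1 + p\<^sup>2) / 2" for p :: real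
      using zero_le_power2[of "p - 1"] by (simp add: power2_diff)
    then have "x + y \<le> (1 + x\<^sup>2) / 2 + (1 + y\<^sup>2) / 2" by (intro add_mono)
    also have "\<dots> \<le> 1 + x\<^sup>2 + y\<^sup>2" by (simp add: field_simps)
    also have "\<dots> \<le> 1 + x\<^sup>2 + y\<^sup>2 + x\<^sup>2 * y\<^sup>2" by simp
    also have "\<dots> = (1 + x\<^sup>2) * (1 + y\<^sup>2)" by algebra
    finally show ?thesis .
  qed
  then have frac: "(x + y) / ((1 + x\<^sup>2) * (1 + y\<^sup>2)) \<le> 1" using px by simp
  have "1 / (1 + x\<^sup>2) - 1 / (1 + y\<^sup>2) = (y - x) * ((x + y) / ((1 + x\<^sup>2) * (1 + y\<^sup>2)))"
    using px by (simp add: field_simps power2_eq_square)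
  then have "\<bar>1 / (1 + x\<^sup>2) - 1 / (1 + y\<^sup>2)\<bar> = \<bar>y - x\<bar> * ((x + y) / ((1 + x\<^sup>2) * (1 + y\<^sup>2)))"
    using px xy by (simp add: abs_mult)
  also have "\<dots> \<le> \<bar>y - x\<bar>" using frac by (intro mult_left_le) auto
  also have "\<dots> \<le> norm (v - w)"
    using norm_triangle_ineq3[of v w] by (simp add: x_def y_def abs_minus_commute)
  finally show ?thesis by (simp add: x_def y_def)
qed

lemma inverse_one_plus_norm_square_power_lipschitz:
  fixes v w :: "'a::real_normed_vector"
  shows "\<bar>1 / (1 + (norm v)\<^sup>2) ^ K - 1 / (1 + (norm w)\<^sup>2) ^ K\<bar> \<le> real K * norm (v - w)"
proof -
  have "\<bar>1 / (1 + (norm v)\<^sup>2)\<bar> \<le> 1" for v :: 'a by (simp add: divide_le_eq add_pos_nonneg)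
  then have "norm ((1 / (1 + (norm v)\<^sup>2)) ^ K - (1 / (1 + (norm w)\<^sup>2)) ^ K)
      \<le> real K * norm (1 / (1 + (norm v)\<^sup>2) - 1 / (1 + (norm w)\<^sup>2))"
    by (intro norm_power_diff) auto
  also have "\<dots> \<le> real K * norm (v - w)"
    using inverse_one_plus_norm_square_lipschitz[of v w] by (intro mult_left_mono) auto
  finally show ?thesis by (simp add: power_one_over)
qed

section \<open>Thin domains and the upper bound\<close>

text \<open>A rational profile, so that the domains below are given by polynomial inequalities.\<close>

definition bump :: "nat \<Rightarrow> 'a::real_normed_vector \<Rightarrow> real" where
  "bump K v = 1 / (1 + (norm v)\<^sup>2) ^ K"

lemma one_plus_norm_square_pos: "0 < 1 + (norm v)\<^sup>2"
  by (simp add: add_pos_nonneg)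

lemma bump_pos: "0 < bump K v"
  by (simp add: bump_def one_plus_norm_square_pos)

lemma bump_le_1: "bump K v \<le> 1"
  by (simp add: bump_def divide_le_eq one_plus_norm_square_pos one_le_power)

lemma continuous_bump: "continuous_on S (bump K)"
  unfolding bump_def by (intro continuous_intros) (auto simp: add_nonneg_eq_0_iff)

lemma borel_measurable_bump [measurable]: "bump K \<in> borel_measurable borel"
  by (intro borel_measurable_continuous_onI continuous_bump)

text \<open>The parametrisation of the graph has Lipschitz constant \<open>1 + c\<close>, which bounds the Hausdorff measure
  of a piece of the graph by the Lebesgue measure of its projection. It plays the part of the area
  formula.\<close>

lemma nn_integral_graph_le:
  fixes i :: "'n::finite" and h :: "real ^ 'n minus_one \<Rightarrow> real"
  assumes card_ge_2: "CARD('n) \<ge> 2" and c: "0 \<le> c"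
    and h: "\<And>v w. \<bar>h v - h w\<bar> \<le> c * dist v w"
    and [measurable]: "h \<in> borel_measurable borel" "f \<in> borel_measurable borel"
  shows "(\<integral>\<^sup>+x. f (drop_coord i x) * indicator {x. x $ i = h (drop_coord i x)} x \<partial>hausdorff (CARD('n) - 1))
    \<le> ennreal ((1 + c) ^ (CARD('n) - 1)) * (\<integral>\<^sup>+v. f v \<partial>lborel)"
proof -
  note [measurable] = borel_measurable_drop_coord[OF card_ge_2]
  let ?m = "CARD('n) - 1"
  let ?L = "ennreal ((1 + c) ^ ?m)"
  let ?H = "hausdorff ?m :: (real ^ 'n) measure"
  let ?G = "{x. x $ i = h (drop_coord i x)}"
  let ?N = "distr (density ?H (indicator ?G)) borel (drop_coord i)"
  let ?M = "density lborel (\<lambda>_. ?L) :: (real ^ 'n minus_one) measure"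
  have dim: "?m = DIM(real ^ 'n minus_one)"
    using card_minus_one[OF card_ge_2] by simp
  have [measurable]: "?G \<in> sets borel" by measurable
  have "?N \<le> ?M"
  proof (subst le_measure)
    show "sets ?N = sets ?M" by simp
    show "\<forall>S\<in>sets ?N. emeasure ?N S \<le> emeasure ?M S"
    proof
      fix S :: "(real ^ 'n minus_one) set" assume "S \<in> sets ?N"
      then have [measurable]: "S \<in> sets borel" by simp
      have "emeasure ?N S = emeasure ?H (?G \<inter> drop_coord i -` S)"
        by (simp add: emeasure_distr emeasure_density indicator_inter_arith[symmetric]
          measurable_sets_borel[OF borel_measurable_drop_coord[OF card_ge_2]])
      also have "\<dots> = hausdorff_outer ?m (?G \<inter> drop_coord i -` S)"
        by (simp add: emeasure_hausdorff measurable_sets_borel[OF borel_measurable_drop_coord[OF card_ge_2]])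
      also have "?G \<inter> drop_coord i -` S \<subseteq> (\<lambda>v. insert_coord i v (h v)) ` S"
      proof
        fix x assume x: "x \<in> ?G \<inter> drop_coord i -` S"
        then have "x = insert_coord i (drop_coord i x) (h (drop_coord i x))"
          using insert_drop_coord[OF card_ge_2, of x i] by simp
        then show "x \<in> (\<lambda>v. insert_coord i v (h v)) ` S" using x by blast
      qed
      then have "hausdorff_outer ?m (?G \<inter> drop_coord i -` S) \<le> hausdorff_outer ?m ((\<lambda>v. insert_coord i v (h v)) ` S)"
        by (rule hausdorff_outer_mono)
      also have "\<dots> \<le> ?L * hausdorff_outer ?m S"
      proof (rule hausdorff_outer_lipschitz_image)
        fix v w
        have "dist (insert_coord i v (h v)) (insert_coord i w (h w)) \<le> dist v w + \<bar>h v - h w\<bar>"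
          by (rule dist_insert_coord_le[OF card_ge_2])
        also have "\<dots> \<le> (1 + c) * dist v w" using h[of v w] by (simp add: distrib_right)
        finally show "dist (insert_coord i v (h v)) (insert_coord i w (h w)) \<le> (1 + c) * dist v w" .
      qed (use c in simp)
      also have "hausdorff_outer ?m S = emeasure lborel S"
        unfolding dim by (rule hausdorff_outer_DIM) simp
      also have "?L * emeasure lborel S = emeasure ?M S"
        by (simp add: emeasure_density nn_integral_cmult_indicator)
      finally show "emeasure ?N S \<le> emeasure ?M S" .
    qed
  qed
  then have "(\<integral>\<^sup>+v. f v \<partial>?N) \<le> (\<integral>\<^sup>+v. f v \<partial>?M)"
    by (intro nn_integral_mono_measure) simp_all
  then show ?thesis by (simp add: nn_integral_density nn_integral_distr nn_integral_cmult nn_integral_multc mult.commute)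
qed

context raised_exponent
begin

definition thin_domain :: "nat \<Rightarrow> real \<Rightarrow> (real ^ 'n) set" where
  "thin_domain K e = {x. \<bar>x $ i\<bar> < e * bump K (drop_coord i x)}"

lemma C_k_on_denominator:
  assumes S: "open S"
  shows "C_k_on k (\<lambda>x. (1 + (norm (drop_coord i x))\<^sup>2) ^ K) S"
proof -
  have "(norm (drop_coord i x))\<^sup>2 = (\<Sum>k\<in>UNIV. (x $ coord i k)\<^sup>2)" for x :: "real ^ 'n"
    unfolding power2_norm_eq_inner inner_vec_def
    by (simp add: power2_eq_square drop_coord_nth[OF card_ge_2])
  then show ?thesis
    by (simp only:) (intro C_k_on_power C_k_on_add C_k_on_sum C_k_on_const C_k_on_bounded_linear
        bounded_linear_vec_nth S)
qed

lemma mem_thin_domain_iff: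
  "x \<in> thin_domain K e \<longleftrightarrow> \<bar>x $ i\<bar> * (1 + (norm (drop_coord i x))\<^sup>2) ^ K < e"
  using one_plus_norm_square_pos[of "drop_coord i x"]
  by (simp add: thin_domain_def bump_def pos_less_divide_eq)

lemma open_thin_domain: "open (thin_domain K e)"
  unfolding thin_domain_def
  by (intro open_Collect_less continuous_intros continuous_on_compose2[OF continuous_bump continuous_drop_coord[OF card_ge_2]]) auto

lemma frontier_thin_domain:
  assumes "x \<in> frontier (thin_domain K e)"
  shows "\<bar>x $ i\<bar> = e * bump K (drop_coord i x)"
proof -
  have "closed {x. \<bar>x $ i\<bar> \<le> e * bump K (drop_coord i x)}"
    by (intro closed_Collect_le continuous_intros continuous_on_compose2[OF continuous_bump continuous_drop_coord[OF card_ge_2]]) auto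
  then have "closure (thin_domain K e) \<subseteq> {x. \<bar>x $ i\<bar> \<le> e * bump K (drop_coord i x)}"
    by (intro closure_minimal) (auto simp: thin_domain_def)
  then show ?thesis
    using assms interior_open[OF open_thin_domain[of K e]] by (auto simp: frontier_def thin_domain_def)
qed

text \<open>On the side of the hyperplane where \<open>x $ i\<close> has sign \<open>s\<close>, the function
  \<open>s * x $ i * (1 + \<bar>x'\<bar>\<^sup>2) ^ K - e\<close> defines the domain.\<close>

lemma smooth_thin_domain:
  assumes e: "0 < e"
  shows "smooth_open_set (thin_domain K e)"
  unfolding smooth_open_set_def
proof (intro conjI ballI open_thin_domain)
  fix x assume "x \<in> frontier (thin_domain K e)"
  then have "\<bar>x $ i\<bar> = e * bump K (drop_coord i x)" by (rule frontier_thin_domain)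
  then have x: "x $ i \<noteq> 0" using mult_pos_pos[OF e bump_pos[of K "drop_coord i x"]] by auto
  define s where "s = sgn (x $ i)"
  have s: "\<bar>s\<bar> = 1" using x by (simp add: s_def abs_sgn_eq)
  define p where "p x = (1 + (norm (drop_coord i x))\<^sup>2) ^ K" for x :: "real ^ 'n"
  define \<phi> where "\<phi> x = s * (x $ i * p x) + (- e)" for x :: "real ^ 'n"
  define U where "U = {y :: real ^ 'n. 0 < s * y $ i}"
  have U: "open U" unfolding U_def by (intro open_Collect_less continuous_intros)
  have smooth: "C_k_on k \<phi> U" for k
    unfolding \<phi>_def p_def
    by (intro C_k_on_add C_k_on_mult C_k_on_const C_k_on_denominator C_k_on_bounded_linear
        bounded_linear_vec_nth U)
  show "\<exists>U \<phi>. open U \<and> x \<in> U \<and> smooth_fun_on \<phi> U \<and>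
      (\<forall>y\<in>U. frechet_derivative \<phi> (at y) \<noteq> (\<lambda>v. 0)) \<and>
      thin_domain K e \<inter> U = {y \<in> U. \<phi> y < 0}"
  proof (intro exI conjI ballI notI)
    show "open U" by fact
    show "x \<in> U" using x by (simp add: U_def s_def sgn_if)
    show "smooth_fun_on \<phi> U" using smooth by (simp add: smooth_fun_on_def)
    show "thin_domain K e \<inter> U = {y \<in> U. \<phi> y < 0}"
    proof -
      have "\<bar>y $ i\<bar> = s * y $ i" if "y \<in> U" for y
        using that s by (auto simp: U_def abs_if mult_less_0_iff zero_less_mult_iff split: if_splits)
      then show ?thesis by (auto simp: mem_thin_domain_iff \<phi>_def p_def mult.assoc)
    qed
    fix y assume y: "y \<in> U" and zero: "frechet_derivative \<phi> (at y) = (\<lambda>v. 0)"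
    \<comment> \<open>Along the line through \<open>y\<close> in direction \<open>i\<close> the function \<open>\<phi>\<close> is affine with slope \<open>s * p y\<close>.\<close>
    let ?l = "\<lambda>r::real. y + r *\<^sub>R axis i 1"
    have "(\<phi> has_derivative (\<lambda>v. 0)) (at (?l 0))"
      using C_k_on_Suc_has_derivative[OF smooth[of 1, simplified One_nat_def] y] zero by simp
    moreover have "(?l has_derivative (\<lambda>r. r *\<^sub>R axis i 1)) (at 0)"
      by (auto intro!: derivative_eq_intros)
    ultimately have d0: "((\<lambda>r. \<phi> (?l r)) has_derivative (\<lambda>r. 0)) (at 0)"
      by (rule has_derivative_compose[rotated])
    have "drop_coord i (?l r) = drop_coord i y" for r
      by (simp add: vec_eq_iff drop_coord_nth[OF card_ge_2] axis_def coord_neq[OF card_ge_2])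
    then have "\<phi> (?l r) = s * ((y $ i + r) * p y) + (- e)" for r
      by (simp add: \<phi>_def p_def)
    moreover have "((\<lambda>r. s * ((y $ i + r) * p y) + (- e)) has_derivative (\<lambda>r. r * (s * p y))) (at 0)"
      by (auto intro!: derivative_eq_intros)
    ultimately have "((\<lambda>r. \<phi> (?l r)) has_derivative (\<lambda>r. r * (s * p y))) (at 0)" by simp
    from has_derivative_unique[OF d0 this] have "0 = 1 * (s * p y)" by metis
    moreover have "0 < p y" unfolding p_def using one_plus_norm_square_pos by (rule zero_less_power)
    ultimately show False using s by auto
  qed
qed

text \<open>The perimeter of one of the two boundary graphs up to Lipschitz distortion, and exactly half of
  \<open>A $ i\<close> times the volume.\<close>

definition profile_integral :: "nat \<Rightarrow> real \<Rightarrow> ennreal" where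
  "profile_integral K e = (\<integral>\<^sup>+v. ennreal (transversal_weight v * (e * bump K v) powr (A $ i)) \<partial>lborel)"

lemma volume_thin_domain:
  assumes e: "0 < e"
  shows "ennreal (A $ i) * weighted_volume B (thin_domain K e) = 2 * profile_integral K e"
proof -
  have half: "ennreal (A $ i) * (\<integral>\<^sup>+x. ennreal (monomial_weight B x) * indicator (thin_domain K e \<inter> {x. 0 < s * x $ i}) x \<partial>lborel)
    = profile_integral K e" if s: "\<bar>s\<bar> = 1" for s
  proof -
    have "ennreal (transversal_weight v) *
        emeasure (power_measure (A $ i)) ({r. insert_coord i v (s * r) \<in> thin_domain K e} \<inter> {0<..})
      = ennreal (transversal_weight v * (e * bump K v) powr (A $ i))" for v
    proof -
      have "{r. insert_coord i v (s * r) \<in> thin_domain K e} \<inter> {0<..} = {0<..<e * bump K v}"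
        using s by (auto simp: thin_domain_def insert_coord_nth[OF card_ge_2] drop_insert_coord[OF card_ge_2] abs_mult)
      then show ?thesis
        using e bump_pos[of K v] A_i_ge_1
        by (simp add: emeasure_power_measure_Ioo ennreal_mult monomial_weight_nonneg)
    qed
    then show ?thesis
      unfolding profile_integral_def using open_thin_domain
      by (subst volume_by_slices(1)[OF s]) auto
  qed
  show ?thesis
    using open_thin_domain half[of 1] half[of "-1"]
    by (subst weighted_volume_halfspaces) (auto simp: distrib_left mult_2)
qed

lemma perimeter_thin_domain_le:
  assumes e: "0 < e"
  shows "weighted_perimeter A (thin_domain K e)
    \<le> ennreal ((1 + e * real K) ^ (CARD('n) - 1)) * (2 * profile_integral K e)"
proof -
  note [measurable] = borel_measurable_drop_coord[OF card_ge_2]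
  let ?H = "hausdorff (CARD('n) - 1) :: (real ^ 'n) measure"
  let ?G = "\<lambda>s. {x. x $ i = s * (e * bump K (drop_coord i x))}"
  let ?f = "\<lambda>v. ennreal (transversal_weight v * (e * bump K v) powr (A $ i))"
  let ?L = "ennreal ((1 + e * real K) ^ (CARD('n) - 1))"
  have graph: "(\<integral>\<^sup>+x. ?f (drop_coord i x) * indicator (?G s) x \<partial>?H) \<le> ?L * profile_integral K e"
    if s: "\<bar>s\<bar> = 1" for s
    unfolding profile_integral_def
  proof (rule nn_integral_graph_le[OF card_ge_2])
    fix v w :: "real ^ 'n minus_one"
    have "\<bar>s * (e * bump K v) - s * (e * bump K w)\<bar> = e * \<bar>bump K v - bump K w\<bar>"
      using s e by (simp add: abs_mult flip: right_diff_distrib)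
    also have "\<dots> \<le> e * (real K * dist v w)"
      using e inverse_one_plus_norm_square_power_lipschitz[of v K w]
      by (intro mult_left_mono) (auto simp: bump_def dist_norm)
    finally show "\<bar>s * (e * bump K v) - s * (e * bump K w)\<bar> \<le> e * real K * dist v w" by simp
  qed (use e in auto)
  have "weighted_perimeter A (thin_domain K e)
      \<le> (\<integral>\<^sup>+x. ?f (drop_coord i x) * indicator (?G 1) x + ?f (drop_coord i x) * indicator (?G (-1)) x \<partial>?H)"
    unfolding weighted_perimeter_def
  proof (rule nn_integral_mono)
    fix x :: "real ^ 'n"
    show "ennreal (monomial_weight A x) * indicator (frontier (thin_domain K e)) x
      \<le> ?f (drop_coord i x) * indicator (?G 1) x + ?f (drop_coord i x) * indicator (?G (-1)) x"
    proof (cases "x \<in> frontier (thin_domain K e)")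
      case True
      then have abs: "\<bar>x $ i\<bar> = e * bump K (drop_coord i x)" by (rule frontier_thin_domain)
      then have w: "ennreal (monomial_weight A x) = ?f (drop_coord i x)"
        by (simp add: weight_A mult.commute)
      from abs have "x \<in> ?G 1 \<or> x \<in> ?G (-1)" by (auto simp: abs_if split: if_splits)
      then show ?thesis unfolding w using True by (auto simp: indicator_def)
    qed simp
  qed
  also have "\<dots> = (\<integral>\<^sup>+x. ?f (drop_coord i x) * indicator (?G 1) x \<partial>?H)
      + (\<integral>\<^sup>+x. ?f (drop_coord i x) * indicator (?G (-1)) x \<partial>?H)"
    by (rule nn_integral_add) measurable
  also have "\<dots> \<le> ?L * profile_integral K e + ?L * profile_integral K e"
    by (intro add_mono graph) auto
  also have "\<dots> = ?L * (2 * profile_integral K e)"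
    by (simp add: mult_2 distrib_left)
  finally show ?thesis .
qed

lemma transversal_weight_le:
  "transversal_weight v \<le> (1 + (norm v)\<^sup>2) powr (\<Sum>k\<in>UNIV. drop_coord i B $ k)"
proof -
  let ?X = "1 + (norm v)\<^sup>2"
  have X: "1 \<le> ?X" by simp
  have "transversal_weight v \<le> (\<Prod>k\<in>UNIV. ?X powr (drop_coord i B $ k))"
    unfolding monomial_weight_def
  proof (rule prod_mono, rule conjI)
    fix k
    have "\<bar>v $ k\<bar> \<le> norm v" by (rule component_le_norm_cart)
    also have "\<dots> \<le> 2 * norm v" by simp
    also have "\<dots> \<le> ?X" using zero_le_power2[of "norm v - 1"] by (simp add: power2_diff)
    finally have "\<bar>v $ k\<bar> \<le> ?X" .
    then show "(if drop_coord i B $ k = 0 then 1 else \<bar>v $ k\<bar> powr drop_coord i B $ k) \<le> ?X powr drop_coord i B $ k"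
      using X B_nonneg by (auto intro: powr_mono2 simp: add_nonneg_eq_0_iff drop_coord_nth[OF card_ge_2])
  qed auto
  also have "\<dots> = ?X powr (\<Sum>k\<in>UNIV. drop_coord i B $ k)"
    using X by (subst powr_sum) (auto simp: add_nonneg_eq_0_iff)
  finally show ?thesis .
qed

text \<open>The factor \<open>(1 + \<bar>v\<bar>\<^sup>2) ^ n\<close> of the denominator compensates the growth of the weight, and the
  remaining power makes the integral converge. Because of \<open>A $ i \<ge> 1\<close> and \<open>bump K v \<le> 1\<close> the exponent \<open>A $ i\<close>
  only helps.\<close>

lemma profile_integral_finite:
  assumes e: "0 < e" and n: "(\<Sum>k\<in>UNIV. drop_coord i B $ k) \<le> real n"
    and K: "K = n + DIM(real ^ 'n minus_one)"
  shows "profile_integral K e < \<infinity>"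
proof -
  let ?D = "DIM(real ^ 'n minus_one)"
  have "profile_integral K e \<le> (\<integral>\<^sup>+v. ennreal (e powr (A $ i)) * ennreal (1 / (1 + (norm (v :: real ^ 'n minus_one))\<^sup>2) ^ ?D) \<partial>lborel)"
    unfolding profile_integral_def
  proof (rule nn_integral_mono)
    fix v :: "real ^ 'n minus_one"
    let ?X = "1 + (norm v)\<^sup>2"
    have X: "1 \<le> ?X" by simp
    have "transversal_weight v \<le> ?X powr real n"
      using transversal_weight_le[of v] powr_mono[OF n X] by linarith
    also have "\<dots> = ?X ^ n" using X by (intro powr_realpow) linarith
    finally have W: "transversal_weight v \<le> ?X ^ n" .
    have "bump K v powr (A $ i) \<le> bump K v powr 1"
      using A_i_ge_1 bump_pos[of K v] bump_le_1[of K v] by (intro powr_mono') auto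
    then have b: "bump K v powr (A $ i) \<le> bump K v" using bump_pos[of K v] by simp
    have "transversal_weight v * (e * bump K v) powr (A $ i)
        = e powr (A $ i) * (transversal_weight v * bump K v powr (A $ i))"
      using e bump_pos[of K v] by (simp add: powr_mult)
    also have "\<dots> \<le> e powr (A $ i) * (?X ^ n * bump K v)"
      using W b by (intro mult_left_mono mult_mono) (auto simp: monomial_weight_nonneg)
    also have "?X ^ n * bump K v = 1 / ?X ^ ?D"
      using one_plus_norm_square_pos[of v] by (simp add: bump_def K power_add)
    finally show "ennreal (transversal_weight v * (e * bump K v) powr (A $ i))
        \<le> ennreal (e powr (A $ i)) * ennreal (1 / ?X ^ ?D)"
      by (subst ennreal_mult[symmetric]) (auto intro: ennreal_leI)
  qed
  also have "\<dots> = ennreal (e powr (A $ i)) * (\<integral>\<^sup>+v. ennreal (1 / (1 + (norm (v :: real ^ 'n minus_one))\<^sup>2) ^ ?D) \<partial>lborel)"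
    by (rule nn_integral_cmult) measurable
  also have "\<dots> < \<infinity>"
    using nn_integral_inverse_one_plus_norm_power_finite[where 'a = "real ^ 'n minus_one"]
    by (simp add: ennreal_mult_less_top)
  finally show ?thesis .
qed

lemma profile_integral_pos:
  assumes e: "0 < e"
  shows "0 < profile_integral K e"
proof (rule ccontr)
  assume "\<not> ?thesis"
  then have "profile_integral K e = 0" by simp
  then have "AE v in lborel. ennreal (transversal_weight v * (e * bump K v) powr (A $ i)) = 0"
    unfolding profile_integral_def by (subst (asm) nn_integral_0_iff_AE) auto
  moreover have "AE v :: real ^ 'n minus_one in lborel. \<forall>k\<in>UNIV. v $ k \<noteq> 0"
    by (rule AE_finite_allI) (simp_all add: AE_nth_neq_0)
  ultimately have "AE v :: real ^ 'n minus_one in lborel. False"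
  proof eventually_elim
    case (elim v)
    have "0 < transversal_weight v"
      unfolding monomial_weight_def using elim(2) by (intro prod_pos) auto
    then have "0 < transversal_weight v * (e * bump K v) powr (A $ i)"
      using e bump_pos[of K v] by simp
    then show False using elim(1) by (simp only: ennreal_eq_0_iff)
  qed
  then show False
    using AE_iff_measurable[of UNIV "lborel :: (real ^ 'n minus_one) measure" "\<lambda>_. False"] by simp
qed

lemma isoperimetric_exponent_eq_1:
  "(real CARD('n) + (\<Sum>j\<in>UNIV. A $ j) - 1) / (real CARD('n) + (\<Sum>j\<in>UNIV. B $ j)) = 1"
proof -
  have sum: "(\<Sum>j\<in>UNIV. A $ j) = (\<Sum>j\<in>UNIV. B $ j) + 1"
    using A_i A_eq_B coord_neq[OF card_ge_2] by (simp add: sum_coord[OF card_ge_2, of _ i])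
  have "0 \<le> (\<Sum>j\<in>UNIV. B $ j)" by (intro sum_nonneg B_nonneg)
  moreover have "0 < real CARD('n)" by simp
  ultimately have "0 < real CARD('n) + (\<Sum>j\<in>UNIV. B $ j)" by linarith
  with sum show ?thesis by simp
qed

lemma isoperimetric_constant_eq_INF:
  "isoperimetric_constant A B =
     (INF \<Omega> \<in> {\<Omega>. smooth_open_set \<Omega> \<and> 0 < weighted_volume B \<Omega> \<and> weighted_volume B \<Omega> < \<infinity>}.
        weighted_perimeter A \<Omega> / weighted_volume B \<Omega>)"
  unfolding isoperimetric_constant_def isoperimetric_exponent_eq_1
  by (rule INF_cong) (auto simp: powr_one_gt_zero_iff enn2real_nonneg less_top)

theorem isoperimetric_constant_eq: "isoperimetric_constant A B = ennreal (A $ i)"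
proof (rule antisym)
  obtain n where n: "(\<Sum>k\<in>UNIV. drop_coord i B $ k) \<le> real n" using real_arch_simple by blast
  define K where "K = n + DIM(real ^ 'n minus_one)"
  let ?L = "\<lambda>e. (1 + e * real K) ^ (CARD('n) - 1)"
  have upper: "isoperimetric_constant A B \<le> ennreal (?L e * (A $ i))" if e: "0 < e" for e
  proof -
    let ?V = "weighted_volume B (thin_domain K e)" and ?P = "weighted_perimeter A (thin_domain K e)"
    have aV: "ennreal (A $ i) * ?V = 2 * profile_integral K e" by (rule volume_thin_domain[OF e])
    have fin: "profile_integral K e < \<infinity>" by (rule profile_integral_finite[OF e n K_def])
    then have "ennreal (A $ i) * ?V \<noteq> top" unfolding aV by (simp add: ennreal_mult_eq_top_iff)
    then have V1: "?V < \<infinity>" using A_i_ge_1 by (auto simp: ennreal_mult_eq_top_iff less_top)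
    have "2 * profile_integral K e \<noteq> 0" using profile_integral_pos[OF e, of K] by simp
    then have V0: "0 < ?V" using aV by (auto simp: zero_less_iff_neq_zero)
    have "isoperimetric_constant A B \<le> ?P / ?V"
      unfolding isoperimetric_constant_eq_INF
      using smooth_thin_domain[OF e] V0 V1 by (intro INF_lower) auto
    also have "\<dots> \<le> (ennreal (?L e) * (ennreal (A $ i) * ?V)) / ?V"
      unfolding aV by (intro divide_right_mono_ennreal perimeter_thin_domain_le e)
    also have "\<dots> = ennreal (?L e) * ennreal (A $ i)"
      using V0 V1 by (simp add: mult.assoc[symmetric] ennreal_mult_divide_eq)
    also have "\<dots> = ennreal (?L e * (A $ i))"
      using e A_i_ge_1 by (simp add: ennreal_mult)
    finally show ?thesis .
  qed
  have "(\<lambda>n. ennreal (?L (1 / real (Suc n)) * (A $ i))) \<longlonglongrightarrow> ennreal ((1 + 0 * real K) ^ (CARD('n) - 1) * (A $ i))"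
    by (intro tendsto_ennrealI tendsto_intros LIMSEQ_Suc[OF lim_1_over_n])
  then have "isoperimetric_constant A B \<le> ennreal ((1 + 0 * real K) ^ (CARD('n) - 1) * (A $ i))"
    by (rule LIMSEQ_le_const) (intro exI allI impI upper, simp)
  then show "isoperimetric_constant A B \<le> ennreal (A $ i)" by simp
  show "ennreal (A $ i) \<le> isoperimetric_constant A B"
    unfolding isoperimetric_constant_eq_INF
  proof (rule INF_greatest, safe)
    fix \<Omega> :: "(real ^ 'n) set"
    assume \<Omega>: "smooth_open_set \<Omega>" "0 < weighted_volume B \<Omega>" "weighted_volume B \<Omega> < \<infinity>"
    have "ennreal (A $ i) = ennreal (A $ i) * weighted_volume B \<Omega> / weighted_volume B \<Omega>"
      using \<Omega> by (simp add: ennreal_mult_divide_eq)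
    also have "\<dots> \<le> weighted_perimeter A \<Omega> / weighted_volume B \<Omega>"
      using \<Omega> by (intro divide_right_mono_ennreal volume_le_perimeter) (auto simp: smooth_open_set_def)
    finally show "ennreal (A $ i) \<le> weighted_perimeter A \<Omega> / weighted_volume B \<Omega>" .
  qed
qed

end

theorem theorem1p2:
  fixes A B :: "real ^ 'n" and i :: 'n
  assumes "CARD('n) \<ge> 2"
    and "\<forall>j. 0 \<le> A $ j"
    and "\<forall>j. 0 \<le> B $ j"
    and "\<forall>j. j \<noteq> i \<longrightarrow> A $ j = B $ j"
    and "A $ i = B $ i + 1"
  shows "isoperimetric_constant A B = ennreal (A $ i)"
proof -
  interpret raised_exponent A B i using assms by unfold_locales auto
  show ?thesis by (rule isoperimetric_constant_eq)
qed

end
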